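(* Let $\mathbf X$ be a one-dimensional branched rough path, $p\in\mathcal P$ a primitive element of the undecorated Connes–Kreimer Hopf algebra $\mathcal H_{\mathrm{CK}}=\mathcal H_{\mathrm{CK}}(\mathbb R)$, and for $k\ge1$ let $$P_k=\sum_{a_1+2a_2+\cdots+ka_k=k}(-1)^{a_1+\cdots+a_k-1}\,\frac{(a_1+\cdots+a_k-1)!}{a_1!\cdots a_k!}\,(p^{\top1})^{a_1}\cdots(p^{\top k})^{a_k}.$$ Then for all $n\ge1$ $$\langle p^{\top n},\mathbf X_{s,t}\rangle=\sum_{k=1}^n\frac kn\,\langle P_k,\mathbf X_{s,t}\rangle\,\langle p^{\top(n-k)},\mathbf X_{s,t}\rangle .$$ As a special case, when $\mathbf X$ is quasi-geometric, for all $m,n\ge1$ $$\langle\pi(\mathscr r_m)^{\top n},\mathbf X_{s,t}\rangle=\sum_{k=1}^n\frac{(-1)^{k-1}}n\,\langle\pi(\mathscr r_{mk}),\mathbf X_{s,t}\rangle\,\langle\pi(\mathscr r_m)^{\top(n-k)},\mathbf X_{s,t}\rangle .$$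
   Context: Sums are over non-negative integers $a_i$. $\mathcal H_{\mathrm{CK}}$ is spanned by (undecorated) non-planar rooted forests, with disjoint union product and $\Delta_{\mathrm{CK}}f=\sum_Af|_A\otimes f|_{A^c}$, over vertex subsets $A$ closed under passing to descendants (upper part on the left); $\mathbf 1$ is the empty forest, $|f|$ the number of vertices, $\mathscr r_m$ the forest of $m$ single vertices, $\mathcal P$ the space of primitives. Natural growth $\top$ is bilinear with $f\top\mathbf 1=f=\mathbf 1\top f$ and $f\top g=\frac1{|g|}\sum_v(\text{graft all roots of }f\text{ onto }v\in g)$ for non-empty forests; $p^{\top n}$ is the $n$-fold iterate bracketed from the left, $p^{\top0}=\mathbf 1$. $p_1\otimes\cdots\otimes p_n\mapsto p_1\top\cdots\top p_n$ is a coalgebra isomorphism $\bigotimes(\mathcal P)\to\mathcal H_{\mathrm{CK}}$ (deconcatenation on the left), and $\pi\colon\mathcal H_{\mathrm{CK}}\to\mathcal P$ is the corresponding projection onto words of length one. A one-dimensional $\rho$-branched rough path assigns to $0\le s\le t\le T$ a linear functional $\langle\cdot,\mathbf X_{s,t}\rangle$ on forests of weight $\le\lfloor\rho\rfloor$ that is multiplicative for the forest product with $\langle\mathbf 1,\mathbf X_{s,t}\rangle=1$, satisfies $\langle h,\mathbf X_{s,t}\rangle=\langle\Delta_{\mathrm{CK}}h,\mathbf X_{s,u}\otimes\mathbf X_{u,t}\rangle$, and $|\langle f,\mathbf X_{s,t}\rangle|=O(\omega(s,t)^{|f|/\rho})$ for a control $\omega$ (continuous, superadditive, zero on the diagonal).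 It extends uniquely to a multiplicative functional with the same properties on all of $\mathcal H_{\mathrm{CK}}$ (its signature), also denoted $\mathbf X$. It is quasi-geometric if it factors through the Hopf algebra morphism $\widetilde{\mathfrak a}\colon\mathcal H_{\mathrm{CK}}\to\mathrm{QSh}(\mathbb R)$ determined by $\widetilde{\mathfrak a}([f])=\widetilde{\mathfrak a}(f)\otimes x$, where $[f]$ joins the roots of $f$ to a new root and $\mathrm{QSh}(\mathbb R)$ is the quasi-shuffle Hopf algebra on words in the letters $x,x^2,x^3,\ldots$ with deconcatenation and $(wa)*(vb)=(w*vb)a+(wa*v)b+(w*v)(ab)$; equivalently $\langle p_1\top\cdots\top p_n,\mathbf X\rangle=0$ whenever some $p_k\in\mathcal P$ lies in the span of the $\pi(f)$ with $f$ having at least one edge. *)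

theory Defs
  imports
    "HOL-Analysis.Analysis"
    "HOL-Analysis.Finite_Function_Topology"
    "HOL-Library.Multiset"
    "HOL-Library.Poly_Mapping"
    "HOL-Library.Product_Plus"
    "HOL-Library.Extended_Nat"
begin

section \<open>Rooted forests\<close>

datatype tree = Node "tree multiset"

type_synonym forest = "tree multiset"

text \<open>The number of vertices \<open>|f|\<close>. (The multiset operation \<open>size\<close> counts the trees of \<open>f\<close> instead.)\<close>

primrec tree_weight :: "tree \<Rightarrow> nat" where
  "tree_weight (Node F) = Suc (\<Sum>\<^sub># (image_mset tree_weight F))"

definition weight :: "forest \<Rightarrow> nat" where
  "weight F = \<Sum>\<^sub># (image_mset tree_weight F)"

text \<open>
  The vertices of a non-planar forest have no names. To sum over vertices or over sets of
  vertices, we choose a representative whose vertices are pairwise distinct natural numbers;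
  \<open>shape_forest\<close> forgets the names.
\<close>

datatype 'v ltree = LNode (lroot: 'v) (lchildren: "'v ltree multiset")

type_synonym 'v lforest = "'v ltree multiset"

primrec shape_tree :: "'v ltree \<Rightarrow> tree" where
  "shape_tree (LNode v C) = Node (image_mset shape_tree C)"

definition shape_forest :: "'v lforest \<Rightarrow> forest" where
  "shape_forest L = image_mset shape_tree L"

primrec tree_labels :: "'v ltree \<Rightarrow> 'v multiset" where
  "tree_labels (LNode v C) = add_mset v (\<Sum>\<^sub># (image_mset tree_labels C))"

definition labels :: "'v lforest \<Rightarrow> 'v multiset" where
  "labels L = \<Sum>\<^sub># (image_mset tree_labels L)"

definition vertices :: "'v lforest \<Rightarrow> 'v set" where
  "vertices L = set_mset (labels L)"

definition distinctly_labelled :: "'v lforest \<Rightarrow> bool" where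
  "distinctly_labelled L \<longleftrightarrow> (\<forall>v. count (labels L) v \<le> 1)"

definition labelling :: "forest \<Rightarrow> nat lforest" where
  "labelling F = (SOME L. distinctly_labelled L \<and> shape_forest L = F)"

lemma labelling_exists: "\<exists>L :: nat lforest. distinctly_labelled L \<and> shape_forest L = F"
proof -
  define fits :: "nat \<Rightarrow> nat multiset \<Rightarrow> bool"
    where "fits n M \<longleftrightarrow> (\<forall>v. count M v \<le> 1) \<and> (\<forall>v \<in># M. n \<le> v)" for n M
  have forest: "\<exists>L :: nat lforest. fits n (labels L) \<and> shape_forest L = F"
    if "\<And>t n. t \<in># F \<Longrightarrow> \<exists>l :: nat ltree. fits n (tree_labels l) \<and> shape_tree l = t" for F n
    using that
  proof (induction F arbitrary: n)
    case empty
    then show ?case by (intro exI[of _ "{#}"]) (simp add: fits_def labels_def shape_forest_def)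
  next
    case (add t F)
    obtain l where l: "fits n (tree_labels l)" "shape_tree l = t" using add.prems[of t n] by auto
    obtain m where m: "\<And>v. v \<in># tree_labels l \<Longrightarrow> v < m" "n \<le> m"
    proof (rule that[of "Suc (n + Max (insert 0 (set_mset (tree_labels l))))"])
      fix v assume "v \<in># tree_labels l"
      then have "v \<le> Max (insert 0 (set_mset (tree_labels l)))" by (intro Max_ge) auto
      then show "v < Suc (n + Max (insert 0 (set_mset (tree_labels l))))" by linarith
    qed simp
    obtain L where L: "fits m (labels L)" "shape_forest L = F" using add by (metis union_iff add_mset_add_single)
    have "count (tree_labels l) v + count (labels L) v \<le> 1" for v
    proof (cases "v < m")
      case True
      then have "count (labels L) v = 0" using L(1) by (metis fits_def not_in_iff not_le)
      then show ?thesis using l(1) by (simp add: fits_def)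
    next
      case False
      then have "count (tree_labels l) v = 0" using m(1) by (metis not_in_iff)
      then show ?thesis using L(1) by (simp add: fits_def)
    qed
    then have "fits n (labels (add_mset l L))"
      using l(1) L(1) m(2) by (auto simp: fits_def labels_def intro: order_trans[of n m])
    moreover have "shape_forest (add_mset l L) = add_mset t F"
      using l(2) L(2) by (simp add: shape_forest_def)
    ultimately show ?case by blast
  qed
  have tree: "\<exists>l :: nat ltree. fits n (tree_labels l) \<and> shape_tree l = t" for t n
  proof (induction t arbitrary: n)
    case (Node F)
    obtain L :: "nat lforest" where L: "fits (Suc n) (labels L)" "shape_forest L = F"
      using forest[of F "Suc n"] Node by blast
    have "count (labels L) n = 0" using L(1) by (metis fits_def not_in_iff not_less_eq_eq order_refl)
    then have "fits n (tree_labels (LNode n L))"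
      using L(1) by (auto simp: fits_def labels_def simp flip: labels_def)
    moreover have "shape_tree (LNode n L) = Node F" using L(2) by (simp add: shape_forest_def)
    ultimately show ?case by blast
  qed
  show ?thesis using forest[of F 0] tree unfolding fits_def distinctly_labelled_def by blast
qed

lemma labelling: "distinctly_labelled (labelling F)" "shape_forest (labelling F) = F"
  using someI_ex[OF labelling_exists[of F]] by (simp_all add: labelling_def)

text \<open>Pairs (vertex, child).\<close>

primrec tree_edges :: "'v ltree \<Rightarrow> ('v \<times> 'v) set" where
  "tree_edges (LNode v C) =
     (\<lambda>c. (v, lroot c)) ` set_mset C \<union> \<Union> (set_mset (image_mset tree_edges C))"

definition edges :: "'v lforest \<Rightarrow> ('v \<times> 'v) set" where
  "edges L = \<Union> (tree_edges ` set_mset L)"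

definition descendant_closed :: "'v lforest \<Rightarrow> 'v set \<Rightarrow> bool" where
  "descendant_closed L A \<longleftrightarrow> (edges L)\<^sup>* `` A \<subseteq> A"

text \<open>\<open>restrict_forest A L\<close> is the forest \<open>L|\<^sub>A\<close> with vertex set \<open>A\<close> and the induced order.\<close>

primrec restrict_tree :: "'v set \<Rightarrow> 'v ltree \<Rightarrow> forest" where
  "restrict_tree A (LNode v C) =
     (if v \<in> A then {# Node (\<Sum>\<^sub># (image_mset (restrict_tree A) C)) #}
      else \<Sum>\<^sub># (image_mset (restrict_tree A) C))"

definition restrict_forest :: "'v set \<Rightarrow> 'v lforest \<Rightarrow> forest" where
  "restrict_forest A L = \<Sum>\<^sub># (image_mset (restrict_tree A) L)"

text \<open>\<open>graft_forest F u L\<close> attaches all roots of \<open>F\<close> to the vertex \<open>u\<close> of \<open>L\<close>.\<close>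

primrec graft_tree :: "forest \<Rightarrow> 'v \<Rightarrow> 'v ltree \<Rightarrow> tree" where
  "graft_tree F u (LNode v C) =
     Node (image_mset (graft_tree F u) C + (if v = u then F else {#}))"

definition graft_forest :: "forest \<Rightarrow> 'v \<Rightarrow> 'v lforest \<Rightarrow> forest" where
  "graft_forest F u L = image_mset (graft_tree F u) L"

section \<open>The Connes--Kreimer Hopf algebra\<close>

text \<open>
  Finitely supported functions on forests. The ring multiplication of the library is convolution
  for the addition of multisets, i.e. the disjoint union product, and \<open>1\<close> is the empty forest.
  The tensor square consists of the finitely supported functions on pairs of forests.
\<close>

type_synonym HCK = "forest \<Rightarrow>\<^sub>0 real"
type_synonym HCK2 = "(forest \<times> forest) \<Rightarrow>\<^sub>0 real"

definition basis :: "'a \<Rightarrow> ('a \<Rightarrow>\<^sub>0 real)" where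
  "basis a = Poly_Mapping.single a 1"

definition linear_extension :: "('a \<Rightarrow> 'b::real_vector) \<Rightarrow> ('a \<Rightarrow>\<^sub>0 real) \<Rightarrow> 'b" where
  "linear_extension \<phi> x = (\<Sum>a \<in> Poly_Mapping.keys x. Poly_Mapping.lookup x a *\<^sub>R \<phi> a)"

definition bilinear_extension ::
    "('a \<Rightarrow> 'b \<Rightarrow> 'c::real_vector) \<Rightarrow> ('a \<Rightarrow>\<^sub>0 real) \<Rightarrow> ('b \<Rightarrow>\<^sub>0 real) \<Rightarrow> 'c" where
  "bilinear_extension \<phi> x y = linear_extension (\<lambda>a. linear_extension (\<phi> a) y) x"

definition tensor :: "('a \<Rightarrow>\<^sub>0 real) \<Rightarrow> ('b \<Rightarrow>\<^sub>0 real) \<Rightarrow> (('a \<times> 'b) \<Rightarrow>\<^sub>0 real)" where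
  "tensor = bilinear_extension (\<lambda>a b. basis (a, b))"

definition coproduct_forest :: "forest \<Rightarrow> HCK2" where
  "coproduct_forest F = (let L = labelling F in
     \<Sum>A | A \<subseteq> vertices L \<and> descendant_closed L A.
       basis (restrict_forest A L, restrict_forest (vertices L - A) L))"

definition coproduct :: "HCK \<Rightarrow> HCK2" where
  "coproduct = linear_extension coproduct_forest"

definition primitives :: "HCK set" where
  "primitives = {p. coproduct p = tensor p 1 + tensor 1 p}"

definition growth_forest :: "forest \<Rightarrow> forest \<Rightarrow> HCK" where
  "growth_forest F G = (if G = {#} then basis F else
     (let L = labelling G in
       (1 / real (weight G)) *\<^sub>R (\<Sum>v \<in> vertices L. basis (graft_forest F v L))))"

definition growth :: "HCK \<Rightarrow> HCK \<Rightarrow> HCK" (infixl "\<top>" 70) where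
  "x \<top> y = bilinear_extension growth_forest x y"

primrec growth_power :: "HCK \<Rightarrow> nat \<Rightarrow> HCK" where
  "growth_power p 0 = 1"
| "growth_power p (Suc n) = growth_power p n \<top> p"

definition growth_word :: "HCK list \<Rightarrow> HCK" where
  "growth_word ps = foldl growth 1 ps"

text \<open>
  Every element is a linear combination of words \<open>p\<^sub>1 \<top> \<dots> \<top> p\<^sub>n\<close> in primitive elements, and
  \<open>p\<^sub>1 \<otimes> \<dots> \<otimes> p\<^sub>n \<mapsto> p\<^sub>1 \<top> \<dots> \<top> p\<^sub>n\<close> is injective on the tensor coalgebra, so the projection onto
  words of length one is the unique linear map with the following values on words.
\<close>

definition primitive_projection :: "HCK \<Rightarrow> HCK" where
  "primitive_projection = (THE \<pi>. linear \<pi> \<and>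
     (\<forall>ps. set ps \<subseteq> primitives \<longrightarrow>
        \<pi> (growth_word ps) = (if length ps = 1 then hd ps else 0)))"

definition isolated_vertices :: "nat \<Rightarrow> forest" where
  "isolated_vertices m = replicate_mset m (Node {#})"

definition P_polynomial :: "HCK \<Rightarrow> nat \<Rightarrow> HCK" where
  "P_polynomial p k =
     (\<Sum>a | (\<forall>i. i \<notin> {1..k} \<longrightarrow> a i = 0) \<and> (\<Sum>i = 1..k. i * a i) = k.
        ((- 1) ^ ((\<Sum>i = 1..k. a i) - 1) * fact ((\<Sum>i = 1..k. a i) - 1)
           / (\<Prod>i = 1..k. fact (a i)))
        *\<^sub>R (\<Prod>i = 1..k. growth_power p i ^ a i))"

section \<open>The quasi-shuffle algebra and the map from forests\<close>

text \<open>The letter \<open>j :: nat\<close> stands for \<open>x^(j+1)\<close>, so \<open>0\<close> is \<open>x\<close> and the product of two letters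
  \<open>i\<close> and \<open>j\<close> is \<open>Suc (i + j)\<close>.\<close>

type_synonym letter = nat
type_synonym QSh = "letter list \<Rightarrow>\<^sub>0 real"

definition letter_times :: "letter \<Rightarrow> letter \<Rightarrow> letter" where
  "letter_times a b = Suc (a + b)"

definition append_letter :: "QSh \<Rightarrow> letter \<Rightarrow> QSh" where
  "append_letter x a = linear_extension (\<lambda>w. basis (w @ [a])) x"

function quasi_shuffle :: "letter list \<Rightarrow> letter list \<Rightarrow> QSh" where
  "quasi_shuffle w v =
     (if w = [] then basis v
      else if v = [] then basis w
      else append_letter (quasi_shuffle (butlast w) v) (last w)
         + append_letter (quasi_shuffle w (butlast v)) (last v)
         + append_letter (quasi_shuffle (butlast w) (butlast v)) (letter_times (last w) (last v)))"
  by pat_completeness auto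
termination by (relation "Wellfounded.measure (\<lambda>(w, v). length w + length v)")
    (auto simp: neq_Nil_conv)

declare quasi_shuffle.simps [simp del]

lemma quasi_shuffle_Nil [simp]: "quasi_shuffle [] v = basis v" "quasi_shuffle w [] = basis w"
  by (subst quasi_shuffle.simps, simp)+

lemma quasi_shuffle_snoc:
  "quasi_shuffle (w @ [a]) (v @ [b]) =
     append_letter (quasi_shuffle w (v @ [b])) a
   + append_letter (quasi_shuffle (w @ [a]) v) b
   + append_letter (quasi_shuffle w v) (letter_times a b)"
  by (subst quasi_shuffle.simps) simp

definition quasi_shuffle_times :: "QSh \<Rightarrow> QSh \<Rightarrow> QSh" where
  "quasi_shuffle_times = bilinear_extension quasi_shuffle"

text \<open>
  The morphism is determined by its values on trees, \<open>[F] \<mapsto> atilde F \<otimes> x\<close>, and by multiplicativity;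
  the quasi-shuffle product is commutative and associative, so the fold is the product over the
  trees of the forest.
\<close>

primrec atilde_tree :: "tree \<Rightarrow> QSh" where
  "atilde_tree (Node F) =
     append_letter (fold_mset quasi_shuffle_times (basis []) (image_mset atilde_tree F)) 0"

definition atilde_forest :: "forest \<Rightarrow> QSh" where
  "atilde_forest F = fold_mset quasi_shuffle_times (basis []) (image_mset atilde_tree F)"

definition atilde :: "HCK \<Rightarrow> QSh" where
  "atilde = linear_extension atilde_forest"

section \<open>Branched rough paths\<close>

text \<open>
  A linear functional is given by its values on forests, and \<open>pairing x X\<close> is \<open>\<langle>x, X\<rangle>\<close>.
\<close>

definition pairing :: "HCK \<Rightarrow> (forest \<Rightarrow> real) \<Rightarrow> real" where
  "pairing x X = linear_extension X x"

definition pairing2 :: "HCK2 \<Rightarrow> (forest \<Rightarrow> real) \<Rightarrow> (forest \<Rightarrow> real) \<Rightarrow> real" where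
  "pairing2 x X Y = linear_extension (\<lambda>(F, G). X F * Y G) x"

definition control :: "real \<Rightarrow> (real \<Rightarrow> real \<Rightarrow> real) \<Rightarrow> bool" where
  "control T \<omega> \<longleftrightarrow>
     continuous_on {(s, t). 0 \<le> s \<and> s \<le> t \<and> t \<le> T} (\<lambda>(s, t). \<omega> s t) \<and>
     (\<forall>s t. 0 \<le> s \<and> s \<le> t \<and> t \<le> T \<longrightarrow> 0 \<le> \<omega> s t) \<and>
     (\<forall>s u t. 0 \<le> s \<and> s \<le> u \<and> u \<le> t \<and> t \<le> T \<longrightarrow> \<omega> s u + \<omega> u t \<le> \<omega> s t) \<and>
     (\<forall>t. 0 \<le> t \<and> t \<le> T \<longrightarrow> \<omega> t t = 0)"

text \<open>
  The rough path axioms on forests of weight at most \<open>N\<close>; values on heavier forests are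
  irrelevant. The estimate is only required for non-empty forests: for the empty forest it reads
  \<open>1 = O(1)\<close>, but \<open>0 powr 0 = 0\<close>.
\<close>

definition multiplicative_functional ::
    "enat \<Rightarrow> real \<Rightarrow> real \<Rightarrow> (real \<Rightarrow> real \<Rightarrow> real) \<Rightarrow> (real \<Rightarrow> real \<Rightarrow> forest \<Rightarrow> real) \<Rightarrow> bool" where
  "multiplicative_functional N \<rho> T \<omega> X \<longleftrightarrow>
     (\<forall>s t. 0 \<le> s \<and> s \<le> t \<and> t \<le> T \<longrightarrow>
        X s t {#} = 1 \<and>
        (\<forall>F G. enat (weight (F + G)) \<le> N \<longrightarrow> X s t (F + G) = X s t F * X s t G)) \<and>
     (\<forall>s u t H. 0 \<le> s \<and> s \<le> u \<and> u \<le> t \<and> t \<le> T \<and> enat (weight H) \<le> N \<longrightarrow>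
        X s t H = pairing2 (coproduct (basis H)) (X s u) (X u t)) \<and>
     (\<forall>F. F \<noteq> {#} \<and> enat (weight F) \<le> N \<longrightarrow>
        (\<exists>C. \<forall>s t. 0 \<le> s \<and> s \<le> t \<and> t \<le> T \<longrightarrow>
           \<bar>X s t F\<bar> \<le> C * \<omega> s t powr (real (weight F) / \<rho>)))"

definition branched_rough_path ::
    "real \<Rightarrow> real \<Rightarrow> (real \<Rightarrow> real \<Rightarrow> forest \<Rightarrow> real) \<Rightarrow> bool" where
  "branched_rough_path \<rho> T X \<longleftrightarrow>
     (\<exists>\<omega>. control T \<omega> \<and> multiplicative_functional (enat (nat \<lfloor>\<rho>\<rfloor>)) \<rho> T \<omega> X)"

text \<open>By the extension theorem, \<open>S\<close> exists and is unique up to its values outside \<open>0 \<le> s \<le> t \<le> T\<close>.\<close>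

definition is_signature ::
    "real \<Rightarrow> real \<Rightarrow> (real \<Rightarrow> real \<Rightarrow> forest \<Rightarrow> real) \<Rightarrow> (real \<Rightarrow> real \<Rightarrow> forest \<Rightarrow> real) \<Rightarrow> bool" where
  "is_signature \<rho> T X S \<longleftrightarrow>
     (\<forall>s t F. 0 \<le> s \<and> s \<le> t \<and> t \<le> T \<and> weight F \<le> nat \<lfloor>\<rho>\<rfloor> \<longrightarrow> S s t F = X s t F) \<and>
     (\<exists>\<omega>. control T \<omega> \<and> multiplicative_functional \<infinity> \<rho> T \<omega> S)"

text \<open>
  The factor \<open>y\<close> is only required to be linear: as \<open>atilde\<close> is onto, \<open>y\<close> is multiplicative whenever
  \<open>S s t\<close> is.
\<close>

definition quasi_geometric :: "real \<Rightarrow> (real \<Rightarrow> real \<Rightarrow> forest \<Rightarrow> real) \<Rightarrow> bool" where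
  "quasi_geometric T S \<longleftrightarrow>
     (\<forall>s t. 0 \<le> s \<and> s \<le> t \<and> t \<le> T \<longrightarrow>
        (\<exists>y :: QSh \<Rightarrow> real. linear y \<and> (\<forall>x. pairing x (S s t) = y (atilde x))))"

end

theory Submission
  imports Defs
begin

text \<open>
  Both identities are obtained by evaluating identities between algebra elements at the character
  \<open>S s t\<close>.

  The first one is a fact about power series. Put \<open>h\<^sub>n = \<langle>p\<^sup>\<top>\<^sup>n, S s t\<rangle>\<close> and \<open>H(z) = \<Sum>h\<^sub>n z\<^sup>n\<close>, so that
  \<open>h\<^sub>0 = 1\<close>. The coefficients of \<open>P\<^sub>k\<close> are those of the logarithm series, and evaluation is
  multiplicative, so \<open>\<langle>P\<^sub>k, S s t\<rangle>\<close> is the coefficient of \<open>z\<^sup>k\<close> in \<open>log H\<close>. The identity compares the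
  coefficients of \<open>z\<^sup>n\<close> in \<open>z H' = z (log H)' H\<close> (\<open>log_coeff_convolution\<close>).

  The second one is proved in the quasi-shuffle algebra and rests on three observations.

  First, if \<open>p\<close> is primitive, then \<open>\<Delta>(x \<top> p) = (x \<top> p) \<otimes> 1 + \<Sum> x\<^sub>1 \<otimes> (x\<^sub>2 \<top> p)\<close> in Sweedler notation
  (\<open>coproduct_growth\<close>), so that words \<open>p\<^sub>1 \<top> \<dots> \<top> p\<^sub>n\<close> in primitive elements are deconcatenated by the
  coproduct. Write \<open>\<epsilon>\<close> for the counit. The equation \<open>x = \<epsilon>(x) 1 + \<Sum> x\<^sub>1 \<top> \<pi>(x\<^sub>2)\<close> determines \<open>\<pi>\<close> by
  recursion on the weight. By coassociativity \<open>\<pi>\<close> has primitive values; hence the same equation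
  exhibits every element as a combination of words, and evaluating it on words shows that \<open>\<pi>\<close> is the
  projection onto words of length one (\<open>primitive_projection_eq\<close>).

  Secondly, let \<open>\<lambda>(f)\<close> be the letter \<open>x\<^sup>m\<close> if \<open>f\<close> consists of \<open>m \<ge> 1\<close> isolated vertices and \<open>0\<close> otherwise.
  Then the morphism \<open>a\<close> from forests to words satisfies \<open>a(f) = \<epsilon>(f) + \<Sum> a(f\<^sub>1) \<lambda>(f\<^sub>2)\<close>, where letters are
  appended (\<open>atilde_eq_last_letter\<close>). Grafting creates edges, so \<open>\<lambda>(x \<top> p) = \<epsilon>(x) \<lambda>(p)\<close> for primitive
  \<open>p\<close>, and therefore \<open>a(x \<top> p) = a(x) \<lambda>(p)\<close> and \<open>\<lambda>(\<pi>(f)) = \<lambda>(f)\<close>. With \<open>c = x\<^sup>m\<close>, the map \<open>a\<close> sends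
  \<open>\<pi>(r\<^sub>m)\<^sup>\<top>\<^sup>n\<close> to the word \<open>c\<dots>c\<close> of length \<open>n\<close> and \<open>\<pi>(r\<^bsub>mk\<^esub>)\<close> to the single letter \<open>x\<^bsup>mk\<^esup>\<close>.

  Thirdly, the quasi-shuffle product of the letter \<open>x\<^bsup>mk\<^esup>\<close> with the word of \<open>n - k\<close> letters \<open>c\<close> is
  \<open>I\<^sub>k + I\<^bsub>k+1\<^esub>\<close>, where \<open>I\<^sub>k\<close> is the sum over all ways of inserting \<open>x\<^bsup>mk\<^esup>\<close> into a word of \<open>n - k\<close> letters
  \<open>c\<close> and \<open>I\<^bsub>n+1\<^esub> = 0\<close>: the letter is either inserted or merged with one of the letters \<open>c\<close>. The alternating sum
  over \<open>k\<close> telescopes to \<open>I\<^sub>1\<close>, which is \<open>n\<close> times the word of \<open>n\<close> letters \<open>c\<close>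
  (\<open>letter_power_recursion\<close>).
\<close>

section \<open>Linear and bilinear extension\<close>

lemma lookup_scaleR [simp]: "Poly_Mapping.lookup (c *\<^sub>R x) a = c *\<^sub>R Poly_Mapping.lookup x a"
  for x :: "'a \<Rightarrow>\<^sub>0 'b::real_vector"
proof -
  have "finite {k. c *\<^sub>R Poly_Mapping.lookup x k \<noteq> 0}"
    by (rule finite_subset[OF _ finite_keys[of x]]) (auto simp: in_keys_iff)
  then show ?thesis by (simp add: scaleR_poly_mapping_def)
qed

lemma linear_extension_superset:
  assumes "finite A" "Poly_Mapping.keys x \<subseteq> A"
  shows "linear_extension \<phi> x = (\<Sum>a\<in>A. Poly_Mapping.lookup x a *\<^sub>R \<phi> a)"
  unfolding linear_extension_def
  by (rule sum.mono_neutral_left) (use assms in \<open>auto simp: in_keys_iff\<close>)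

lemma linear_linear_extension: "linear (linear_extension \<phi>)"
proof (rule linearI)
  fix x y :: "'a \<Rightarrow>\<^sub>0 real"
  let ?A = "Poly_Mapping.keys x \<union> Poly_Mapping.keys y"
  have "Poly_Mapping.keys (x + y) \<subseteq> ?A" by (rule Poly_Mapping.keys_add)
  then show "linear_extension \<phi> (x + y) = linear_extension \<phi> x + linear_extension \<phi> y"
    by (simp add: linear_extension_superset[of ?A] lookup_add scaleR_add_left sum.distrib)
next
  fix c and x :: "'a \<Rightarrow>\<^sub>0 real"
  have "Poly_Mapping.keys (c *\<^sub>R x) \<subseteq> Poly_Mapping.keys x" by (auto simp: in_keys_iff)
  then show "linear_extension \<phi> (c *\<^sub>R x) = c *\<^sub>R linear_extension \<phi> x"
    by (simp add: linear_extension_superset[of "Poly_Mapping.keys x"] scaleR_sum_right)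
qed

lemmas linear_extension_add = linear_add[OF linear_linear_extension]
  and linear_extension_scaleR = linear_scale[OF linear_linear_extension]
  and linear_extension_0 [simp] = linear_0[OF linear_linear_extension]
  and linear_extension_sum = linear_sum[OF linear_linear_extension]

lemma linear_extension_basis [simp]: "linear_extension \<phi> (basis a) = \<phi> a"
  by (simp add: linear_extension_def basis_def)

lemma linear_extension_expand: "linear_extension basis x = x"
proof (rule poly_mapping_eqI)
  fix k
  have "Poly_Mapping.lookup (linear_extension basis x) k =
      (\<Sum>a\<in>Poly_Mapping.keys x. Poly_Mapping.lookup x a * (1 when a = k))"
    by (simp add: linear_extension_def lookup_sum basis_def lookup_single)
  also have "\<dots> = (\<Sum>a\<in>Poly_Mapping.keys x. if a = k then Poly_Mapping.lookup x a else 0)"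
    by (rule sum.cong) (auto simp: when_def)
  also have "\<dots> = Poly_Mapping.lookup x k" by (auto simp: sum.delta in_keys_iff)
  finally show "Poly_Mapping.lookup (linear_extension basis x) k = Poly_Mapping.lookup x k" .
qed

lemma linear_image_linear_extension:
  assumes "linear f"
  shows "f (linear_extension \<phi> x) = linear_extension (\<lambda>a. f (\<phi> a)) x"
  unfolding linear_extension_def by (simp add: linear_sum[OF assms] linear_scale[OF assms])

lemma linear_eq_on_basis:
  assumes "linear f" "linear g" "\<And>a. f (basis a) = g (basis a)"
  shows "f x = g x"
proof -
  have expand: "f x = linear_extension (\<lambda>a. f (basis a)) x" if "linear f" for f :: "('a \<Rightarrow>\<^sub>0 real) \<Rightarrow> 'b"
    using linear_image_linear_extension[OF that, of basis x] by (simp add: linear_extension_expand)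
  then show ?thesis using expand[OF assms(1)] expand[OF assms(2)] assms(3) by simp
qed

lemma linear_extension_cong:
  "(\<And>a. a \<in> Poly_Mapping.keys x \<Longrightarrow> \<phi> a = \<psi> a) \<Longrightarrow> linear_extension \<phi> x = linear_extension \<psi> x"
  by (simp add: linear_extension_def)

lemma linear_extension_fun_add:
  "linear_extension (\<lambda>a. \<phi> a + \<psi> a) x = linear_extension \<phi> x + linear_extension \<psi> x"
  by (simp add: linear_extension_def scaleR_add_right sum.distrib)

lemma linear_extension_fun_diff:
  "linear_extension (\<lambda>a. \<phi> a - \<psi> a) x = linear_extension \<phi> x - linear_extension \<psi> x"
  by (simp add: linear_extension_def scaleR_diff_right sum_subtractf)

lemma linear_extension_fun_0 [simp]: "linear_extension (\<lambda>a. 0) x = 0"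
  by (simp add: linear_extension_def)

lemma lookup_basis: "Poly_Mapping.lookup (basis a) b = (if a = b then 1 else 0)"
  by (simp add: basis_def lookup_single when_def)

lemma linear_lookup: "linear (\<lambda>x :: 'a \<Rightarrow>\<^sub>0 real. Poly_Mapping.lookup x a)"
  by (rule linearI) (simp_all add: lookup_add)

lemma scaleR_conv_mult: "c *\<^sub>R x = Poly_Mapping.single 0 c * x"
  for x :: "'a::monoid_add \<Rightarrow>\<^sub>0 real"
proof -
  have "c *\<^sub>R x = Poly_Mapping.map ((*) c) x"
    by (rule poly_mapping_eqI) (simp add: Poly_Mapping.map.rep_eq when_def)
  then show ?thesis by (simp add: mult_map_scale_conv_mult)
qed

lemma mult_scaleR:
  fixes x y :: "'a::comm_monoid_add \<Rightarrow>\<^sub>0 real"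
  shows "(c *\<^sub>R x) * y = c *\<^sub>R (x * y)" "x * (c *\<^sub>R y) = c *\<^sub>R (x * y)"
  by (simp_all add: scaleR_conv_mult mult_ac)

lemma basis_mult: "basis a * basis b = basis (a + b)"
  by (simp add: basis_def mult_single)

lemma basis_0: "basis 0 = 1"
  by (simp add: basis_def)

lemma basis_empty [simp]: "basis {#} = 1"
  using basis_0 by simp

text \<open>
  Nearly every identity below is an equality of linear or bilinear maps and is therefore checked on
  basis elements only. These introduction rules discharge the linearity of both sides.
\<close>

named_theorems linears

lemma linear_id' [linears]: "linear (\<lambda>x. x)"
  using linear_id by (simp add: id_def)

lemma linear_zero' [linears]: "linear (\<lambda>x. 0)"
  by (rule linearI) simp_all

lemma linear_extension_comp [linears]: "linear f \<Longrightarrow> linear (\<lambda>x. linear_extension \<phi> (f x))"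
  using linear_compose[OF _ linear_linear_extension] by (simp add: o_def)

lemma linear_add_comp [linears]: "linear f \<Longrightarrow> linear g \<Longrightarrow> linear (\<lambda>x. f x + g x)"
  by (rule linear_compose_add)

lemma linear_diff_comp [linears]: "linear f \<Longrightarrow> linear g \<Longrightarrow> linear (\<lambda>x. f x - g x)"
  by (rule linear_compose_sub)

lemma linear_scaleR_comp [linears]: "linear f \<Longrightarrow> linear (\<lambda>x. c *\<^sub>R f x)"
  by (rule linear_compose_scale_right)

lemma linear_scaleR_left_comp [linears]: "linear f \<Longrightarrow> linear (\<lambda>x. f x *\<^sub>R v)"
  by (rule linearI) (simp_all add: linear_add linear_scale scaleR_add_left)

lemma linear_lookup_comp [linears]:
  "linear f \<Longrightarrow> linear (\<lambda>x. Poly_Mapping.lookup (f x :: 'a \<Rightarrow>\<^sub>0 real) a)"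
  using linear_compose[OF _ linear_lookup] by (simp add: o_def)

lemma linear_mult_left_comp [linears]:
  "linear f \<Longrightarrow> linear (\<lambda>x. c * (f x :: 'a::comm_monoid_add \<Rightarrow>\<^sub>0 real))"
  by (rule linearI) (simp_all add: linear_add linear_scale distrib_left mult_scaleR)

lemma linear_mult_right_comp [linears]:
  "linear f \<Longrightarrow> linear (\<lambda>x. (f x :: 'a::comm_monoid_add \<Rightarrow>\<^sub>0 real) * c)"
  by (rule linearI) (simp_all add: linear_add linear_scale distrib_right mult_scaleR)

lemma linear_linear_extension_fun [linears]:
  assumes "\<And>a. linear (\<lambda>x. \<phi> x a)"
  shows "linear (\<lambda>x. linear_extension (\<phi> x) y)"
  unfolding linear_extension_def
  by (rule linearI)
    (simp_all add: linear_add[OF assms] linear_scale[OF assms] scaleR_add_right sum.distrib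
      scaleR_sum_right mult_ac)

lemma linear_bilinear_extension_left [linears]:
  "linear f \<Longrightarrow> linear (\<lambda>x. bilinear_extension \<phi> (f x) y)"
  unfolding bilinear_extension_def by (rule linear_extension_comp)

lemma linear_bilinear_extension_right [linears]:
  "linear f \<Longrightarrow> linear (\<lambda>x. bilinear_extension \<phi> y (f x))"
  unfolding bilinear_extension_def by (intro linears) auto

lemma bilinear_extension_basis [simp]:
  "bilinear_extension \<phi> (basis a) (basis b) = \<phi> a b"
  by (simp add: bilinear_extension_def)

lemma bilinear_eq_on_basis:
  assumes "\<And>y. linear (\<lambda>x. f x y)" "\<And>x. linear (f x)" "\<And>y. linear (\<lambda>x. g x y)" "\<And>x. linear (g x)"
    and "\<And>a b. f (basis a) (basis b) = g (basis a) (basis b)"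
  shows "f x y = g x y"
proof (rule linear_eq_on_basis[where f = "\<lambda>x. f x y" and g = "\<lambda>x. g x y"])
  show "f (basis a) y = g (basis a) y" for a
    by (rule linear_eq_on_basis) (use assms in auto)
qed (use assms in auto)

text \<open>
  Maps on the tensor square are extended from functions of the form \<open>\<lambda>(A, B). \<phi> x A B\<close>. Their
  linearity in \<open>x\<close> must be derived under the case distinction on the pair.
\<close>

lemma linear_case_prod [linears]:
  "(\<And>a b. linear (\<lambda>x. \<phi> x a b)) \<Longrightarrow> linear (\<lambda>x. case p of (a, b) \<Rightarrow> \<phi> x a b)"
  by (cases p) simp

lemma linear_tensor [linears]:
  "linear f \<Longrightarrow> linear (\<lambda>x. tensor (f x) y)" "linear f \<Longrightarrow> linear (\<lambda>x. tensor y (f x))"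
  unfolding tensor_def by (intro linears; assumption)+

lemma linear_growth [linears]:
  "linear f \<Longrightarrow> linear (\<lambda>x. f x \<top> y)" "linear f \<Longrightarrow> linear (\<lambda>x. y \<top> f x)"
  unfolding growth_def by (intro linears; assumption)+

lemma linear_coproduct [linears]: "linear f \<Longrightarrow> linear (\<lambda>x. coproduct (f x))"
  unfolding coproduct_def by (intro linears)

lemma tensor_basis: "tensor (basis a) (basis b) = basis (a, b)"
  by (simp add: tensor_def)

lemma growth_basis: "basis F \<top> basis G = growth_forest F G"
  by (simp add: growth_def)

lemma coproduct_basis: "coproduct (basis F) = coproduct_forest F"
  by (simp add: coproduct_def)

lemma tensor_mult:
  fixes x x' :: "'a::comm_monoid_add \<Rightarrow>\<^sub>0 real" and y y' :: "'b::comm_monoid_add \<Rightarrow>\<^sub>0 real"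
  shows "tensor x y * tensor x' y' = tensor (x * x') (y * y')"
proof -
  have 1: "tensor (basis a) (basis b) * tensor (basis a') (basis b')
      = tensor (basis a * basis a') (basis b * basis b')" for a a' :: 'a and b b' :: 'b
    by (simp add: tensor_basis basis_mult)
  have 2: "tensor (basis a) (basis b) * tensor x' y' = tensor (basis a * x') (basis b * y')" for a b
    by (rule bilinear_eq_on_basis[where f = "\<lambda>x' y'. tensor (basis a) (basis b) * tensor x' y'"])
      (intro linears 1)+
  show ?thesis
    by (rule bilinear_eq_on_basis[where f = "\<lambda>x y. tensor x y * tensor x' y'"]) (intro linears 2)+
qed

lemma linear_extension_mult2:
  fixes x y :: "'a::comm_monoid_add \<Rightarrow>\<^sub>0 real"
  assumes "\<And>y. linear (\<lambda>x. B x y)" "\<And>x. linear (B x)"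
    and "\<And>a b. \<theta> (a + b) = B (\<phi> a) (\<psi> b)"
  shows "linear_extension \<theta> (x * y) = B (linear_extension \<phi> x) (linear_extension \<psi> y)"
proof (rule bilinear_eq_on_basis[where f = "\<lambda>x y. linear_extension \<theta> (x * y)"])
  show "linear (\<lambda>x. B (linear_extension \<phi> x) (linear_extension \<psi> y))" for y
    using linear_compose[OF linear_linear_extension assms(1)] by (simp add: o_def)
  show "linear (\<lambda>y. B (linear_extension \<phi> x) (linear_extension \<psi> y))" for x
    using linear_compose[OF linear_linear_extension assms(2)] by (simp add: o_def)
qed (auto intro!: linears simp: basis_mult assms(3))

lemma linear_extension_times:
  fixes x y :: "'a::comm_monoid_add \<Rightarrow>\<^sub>0 real"
  assumes "\<And>a b. \<theta> (a + b) = \<phi> a * (\<psi> b :: 'b::comm_monoid_add \<Rightarrow>\<^sub>0 real)"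
  shows "linear_extension \<theta> (x * y) = linear_extension \<phi> x * linear_extension \<psi> y"
  by (rule linear_extension_mult2) (auto intro!: linears simp: assms)

lemma keys_linear_extension:
  "Poly_Mapping.keys (linear_extension \<phi> x) \<subseteq> (\<Union>a\<in>Poly_Mapping.keys x. Poly_Mapping.keys (\<phi> a))"
  for \<phi> :: "'a \<Rightarrow> 'b \<Rightarrow>\<^sub>0 real"
proof -
  have "Poly_Mapping.keys (c *\<^sub>R y) \<subseteq> Poly_Mapping.keys y" for c and y :: "'b \<Rightarrow>\<^sub>0 real"
    by (auto simp: in_keys_iff)
  then show ?thesis unfolding linear_extension_def by (rule order_trans[OF keys_sum UN_mono[OF order_refl]])
qed

lemma keys_basis [simp]: "Poly_Mapping.keys (basis a) = {a}"
  by (simp add: basis_def)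

lemma linear_extension_fun_scaleR:
  "linear_extension (\<lambda>a. c *\<^sub>R \<phi> a) x = c *\<^sub>R linear_extension \<phi> x"
  by (simp add: linear_extension_def scaleR_sum_right mult.commute)

section \<open>Recursion over forests\<close>

lemma basis_empty_pair [simp]: "basis ({#}, {#}) = (1 :: HCK2)"
  using basis_0[where ?'a = "forest \<times> forest"] by (simp only: zero_prod_def zero_multiset_def)

text \<open>
  Forests are generated from the empty forest by disjoint union and by joining all roots to a new
  one. The coproduct, grafting and the morphism to words all have a simple rule for either
  operation, which makes this the induction scheme for the identities between them.
\<close>

lemma forest_induct [case_names empty node union]:
  assumes empty: "P {#}"
    and node: "\<And>F. P F \<Longrightarrow> P {#Node F#}"
    and union: "\<And>F G. P F \<Longrightarrow> P G \<Longrightarrow> P (F + G)"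
  shows "P (F :: forest)"
proof -
  have forest: "P F" if "\<And>t. t \<in># F \<Longrightarrow> P {#t#}" for F
    using that
  proof (induction F)
    case (add t F)
    then have "P ({#t#} + F)" by (intro union) auto
    then show ?case by simp
  qed (rule empty)
  have "P {#t#}" for t
    by (induction t) (rule node, rule forest)
  then show ?thesis by (rule forest)
qed

text \<open>
  The same scheme for labelled forests, used wherever sums run over vertices or sets of vertices.
\<close>

lemma lforest_induct [case_names empty node union]:
  assumes empty: "P {#}"
    and node: "\<And>v L. P L \<Longrightarrow> P {#LNode v L#}"
    and union: "\<And>L M. P L \<Longrightarrow> P M \<Longrightarrow> P (L + M)"
  shows "P (L :: 'v lforest)"
proof -
  have forest: "P L" if "\<And>t. t \<in># L \<Longrightarrow> P {#t#}" for L
    using that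
  proof (induction L)
    case (add t L)
    then have "P ({#t#} + L)" by (intro union) auto
    then show ?case by simp
  qed (rule empty)
  have "P {#t#}" for t
    by (induction t) (rule node, rule forest)
  then show ?thesis by (rule forest)
qed

lemma weight_simps [simp]:
  "weight {#} = 0" "weight {#Node F#} = Suc (weight F)" "weight (F + G) = weight F + weight G"
  by (simp_all add: weight_def)

lemma weight_eq_0_iff [simp]: "weight F = 0 \<longleftrightarrow> F = {#}"
  by (induction F rule: forest_induct) auto

lemma shape_forest_simps [simp]:
  "shape_forest {#} = {#}" "shape_forest {#LNode v L#} = {#Node (shape_forest L)#}"
  "shape_forest (L + M) = shape_forest L + shape_forest M"
  by (simp_all add: shape_forest_def)

lemma vertices_simps [simp]:
  "vertices {#} = {}" "vertices {#LNode v L#} = insert v (vertices L)"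
  "vertices (L + M) = vertices L \<union> vertices M"
  by (auto simp: vertices_def labels_def)

lemma finite_vertices [simp]: "finite (vertices L)"
  by (simp add: vertices_def)

lemma edges_simps [simp]:
  "edges {#} = {}"
  "edges {#LNode v L#} = (\<lambda>c. (v, lroot c)) ` set_mset L \<union> edges L"
  "edges (L + M) = edges L \<union> edges M"
  by (auto simp: edges_def)

lemma restrict_forest_simps [simp]:
  "restrict_forest A {#} = {#}"
  "restrict_forest A {#LNode v L#} =
     (if v \<in> A then {#Node (restrict_forest A L)#} else restrict_forest A L)"
  "restrict_forest A (L + M) = restrict_forest A L + restrict_forest A M"
  by (simp_all add: restrict_forest_def)

lemma graft_forest_simps [simp]:
  "graft_forest F u {#} = {#}"
  "graft_forest F u {#LNode v L#} = {#Node (graft_forest F u L + (if v = u then F else {#}))#}"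
  "graft_forest F u (L + M) = graft_forest F u L + graft_forest F u M"
  by (simp_all add: graft_forest_def)

lemma distinctly_labelled_node:
  assumes "distinctly_labelled {#LNode v L#}"
  shows "distinctly_labelled L" "v \<notin> vertices L"
proof -
  have "count {#v#} u + count (labels L) u \<le> 1" for u
    using assms by (auto simp: distinctly_labelled_def labels_def dest: spec[of _ u])
  then show "distinctly_labelled L" "v \<notin> vertices L"
    unfolding distinctly_labelled_def vertices_def
    by (metis add_leD2, metis add_le_same_cancel1 count_eq_zero_iff count_single le_zero_eq)
qed

lemma distinctly_labelled_union:
  assumes "distinctly_labelled (L + M)"
  shows "distinctly_labelled L" "distinctly_labelled M" "vertices L \<inter> vertices M = {}"
proof -
  have c: "count (labels L) u + count (labels M) u \<le> 1" for u
    using assms by (auto simp: distinctly_labelled_def labels_def)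
  then show "distinctly_labelled L" "distinctly_labelled M"
    unfolding distinctly_labelled_def by (metis add_leD1, metis add_leD2)
  show "vertices L \<inter> vertices M = {}"
  proof (rule ccontr)
    assume "vertices L \<inter> vertices M \<noteq> {}"
    then obtain u where "u \<in># labels L" "u \<in># labels M"
      by (auto simp: vertices_def)
    then have "1 \<le> count (labels L) u" "1 \<le> count (labels M) u" by simp_all
    then show False using c[of u] by linarith
  qed
qed

subsection \<open>Cuts\<close>

lemma restrict_forest_cong:
  "A \<inter> vertices L = B \<inter> vertices L \<Longrightarrow> restrict_forest A L = restrict_forest B L"
proof (induction L rule: lforest_induct)
  case (node v L)
  have "A \<inter> vertices L = B \<inter> vertices L" "v \<in> A \<longleftrightarrow> v \<in> B" using node.prems by auto
  then show ?case using node.IH by simp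
next
  case (union L M)
  have "A \<inter> vertices L = B \<inter> vertices L" "A \<inter> vertices M = B \<inter> vertices M"
    using union.prems by auto
  then show ?case using union.IH by simp
qed simp

lemma restrict_forest_all: "vertices L \<subseteq> A \<Longrightarrow> restrict_forest A L = shape_forest L"
  by (induction L rule: lforest_induct) auto

lemma restrict_forest_none: "A \<inter> vertices L = {} \<Longrightarrow> restrict_forest A L = {#}"
  by (induction L rule: lforest_induct) (auto simp: Int_Un_distrib)

lemma lroot_in_vertices: "t \<in># L \<Longrightarrow> lroot t \<in> vertices L"
  by (cases t) (force simp: vertices_def labels_def)

lemma edges_subset: "edges L \<subseteq> vertices L \<times> vertices L"
  by (induction L rule: lforest_induct) (auto dest: lroot_in_vertices)

definition closed_under :: "('v \<times> 'v) set \<Rightarrow> 'v set \<Rightarrow> bool" where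
  "closed_under E A \<longleftrightarrow> (\<forall>(x, y)\<in>E. x \<in> A \<longrightarrow> y \<in> A)"

lemma descendant_closed_iff: "descendant_closed L A \<longleftrightarrow> closed_under (edges L) A"
proof
  show "closed_under (edges L) A" if "descendant_closed L A"
    using that by (auto simp: descendant_closed_def closed_under_def)
  show "descendant_closed L A" if cl: "closed_under (edges L) A"
  proof -
    have "y \<in> A" if "(x, y) \<in> (edges L)\<^sup>*" "x \<in> A" for x y
      using that by induction (use cl in \<open>auto simp: closed_under_def\<close>)
    then show ?thesis by (auto simp: descendant_closed_def)
  qed
qed

text \<open>
  Every vertex is a descendant of a root. This is why an upper part of a tree that contains the
  root is the whole tree.
\<close>

lemma closed_under_roots:
  "closed_under (edges L) A \<Longrightarrow> lroot ` set_mset L \<subseteq> A \<Longrightarrow> vertices L \<subseteq> A"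
proof (induction L rule: lforest_induct)
  case (node v L)
  then have "lroot ` set_mset L \<subseteq> A" "closed_under (edges L) A"
    by (auto simp: closed_under_def)
  then show ?case using node by auto
qed (auto simp: closed_under_def)

definition upper_parts :: "'v lforest \<Rightarrow> 'v set set" where
  "upper_parts L = {A. A \<subseteq> vertices L \<and> closed_under (edges L) A}"

lemma upper_parts_node:
  assumes "v \<notin> vertices L"
  shows "upper_parts {#LNode v L#} = insert (insert v (vertices L)) (upper_parts L)"
proof (rule set_eqI)
  fix A
  show "A \<in> upper_parts {#LNode v L#} \<longleftrightarrow> A \<in> insert (insert v (vertices L)) (upper_parts L)"
  proof (cases "v \<in> A")
    case True
    have "A = insert v (vertices L)" if A: "A \<in> upper_parts {#LNode v L#}"
    proof -
      have "closed_under (edges L) A" "lroot ` set_mset L \<subseteq> A"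
        using A True by (auto simp: upper_parts_def closed_under_def)
      from closed_under_roots[OF this] show ?thesis
        using A True by (auto simp: upper_parts_def)
    qed
    moreover have "insert v (vertices L) \<in> upper_parts {#LNode v L#}"
      using edges_subset[of L] lroot_in_vertices[of _ L] by (auto simp: upper_parts_def closed_under_def)
    ultimately show ?thesis using True assms by (auto simp: upper_parts_def)
  next
    case False
    then show ?thesis using assms by (auto simp: upper_parts_def closed_under_def)
  qed
qed

lemma upper_parts_union:
  assumes "vertices L \<inter> vertices M = {}"
  shows "bij_betw (\<lambda>(A, B). A \<union> B) (upper_parts L \<times> upper_parts M) (upper_parts (L + M))"
proof (rule bij_betwI[where g = "\<lambda>A. (A \<inter> vertices L, A \<inter> vertices M)"])
  show "(\<lambda>(A, B). A \<union> B) \<in> upper_parts L \<times> upper_parts M \<rightarrow> upper_parts (L + M)"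
  proof clarify
    fix A B assume "A \<in> upper_parts L" "B \<in> upper_parts M"
    then have AB: "A \<subseteq> vertices L" "B \<subseteq> vertices M"
      "\<And>x y. (x, y) \<in> edges L \<Longrightarrow> x \<in> A \<Longrightarrow> y \<in> A" "\<And>x y. (x, y) \<in> edges M \<Longrightarrow> x \<in> B \<Longrightarrow> y \<in> B"
      by (auto simp: upper_parts_def closed_under_def)
    have "y \<in> A \<union> B" if "(x, y) \<in> edges L \<union> edges M" "x \<in> A \<union> B" for x y
      using that
    proof (elim UnE)
      assume "(x, y) \<in> edges L" "x \<in> B"
      then show ?thesis using AB(2) edges_subset[of L] assms by blast
    next
      assume "(x, y) \<in> edges M" "x \<in> A"
      then show ?thesis using AB(1) edges_subset[of M] assms by blast
    qed (use AB in blast)+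
    then show "A \<union> B \<in> upper_parts (L + M)"
      using AB(1,2) unfolding upper_parts_def closed_under_def by auto
  qed
  show "(\<lambda>A. (A \<inter> vertices L, A \<inter> vertices M)) \<in> upper_parts (L + M) \<rightarrow> upper_parts L \<times> upper_parts M"
  proof
    fix A assume "A \<in> upper_parts (L + M)"
    then have "\<And>x y. (x, y) \<in> edges L \<union> edges M \<Longrightarrow> x \<in> A \<Longrightarrow> y \<in> A"
      by (auto simp: upper_parts_def closed_under_def)
    then have "closed_under (edges L) (A \<inter> vertices L)" "closed_under (edges M) (A \<inter> vertices M)"
      unfolding closed_under_def using edges_subset[of L] edges_subset[of M] by blast+
    then show "(A \<inter> vertices L, A \<inter> vertices M) \<in> upper_parts L \<times> upper_parts M"
      by (simp add: upper_parts_def)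
  qed
qed (use assms in \<open>auto simp: upper_parts_def\<close>)

definition cut :: "'v lforest \<Rightarrow> 'v set \<Rightarrow> HCK2" where
  "cut L A = basis (restrict_forest A L, restrict_forest (vertices L - A) L)"

text \<open>
  The operator \<open>id \<otimes> B\<close>, where \<open>B\<close> joins all roots to a new one.
\<close>

definition below_root :: "HCK2 \<Rightarrow> HCK2" where
  "below_root = linear_extension (\<lambda>(F, G). basis (F, {#Node G#}))"

text \<open>
  The coproduct by recursion over the tree, without reference to a labelling. Cuts of the trees of a
  forest are combined by the componentwise disjoint union, that is, by the multiplication of \<open>HCK2\<close>.
\<close>

primrec cut_tree :: "tree \<Rightarrow> HCK2" where
  "cut_tree (Node F) = basis ({#Node F#}, {#}) + below_root (\<Prod>\<^sub># (image_mset cut_tree F))"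

definition cut_forest :: "forest \<Rightarrow> HCK2" where
  "cut_forest F = \<Prod>\<^sub># (image_mset cut_tree F)"

lemma cut_forest_simps:
  "cut_forest {#} = 1"
  "cut_forest {#Node F#} = basis ({#Node F#}, {#}) + below_root (cut_forest F)"
  "cut_forest (F + G) = cut_forest F * cut_forest G"
  by (simp_all add: cut_forest_def)

lemma finite_upper_parts [simp]: "finite (upper_parts L)"
  by (rule finite_subset[of _ "Pow (vertices L)"]) (auto simp: upper_parts_def)

text \<open>
  The sum over cuts is the same for every labelling by distinct vertices, since it satisfies the
  recursion that defines \<open>cut_forest\<close>: cuts of a disjoint union are pairs of cuts, and a
  cut of a tree either has the whole tree as its upper part or is a cut of the forest obtained by
  deleting the root.
\<close>

lemma sum_cuts: "distinctly_labelled L \<Longrightarrow> (\<Sum>A\<in>upper_parts L. cut L A) = cut_forest (shape_forest L)"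
proof (induction L rule: lforest_induct)
  case empty
  have "upper_parts ({#} :: 'a lforest) = {{}}" by (auto simp: upper_parts_def closed_under_def)
  then show ?case by (simp add: cut_def cut_forest_simps)
next
  case (node v L)
  note d = distinctly_labelled_node[OF node.prems]
  have "insert v (vertices L) \<notin> upper_parts L" using d by (auto simp: upper_parts_def)
  then have "(\<Sum>A\<in>upper_parts {#LNode v L#}. cut {#LNode v L#} A) =
      cut {#LNode v L#} (insert v (vertices L)) + (\<Sum>A\<in>upper_parts L. cut {#LNode v L#} A)"
    by (simp add: upper_parts_node[OF d(2)])
  also have "cut {#LNode v L#} (insert v (vertices L)) = basis ({#Node (shape_forest L)#}, {#})"
    by (simp add: cut_def restrict_forest_all restrict_forest_none subset_insertI)
  also have "(\<Sum>A\<in>upper_parts L. cut {#LNode v L#} A) = (\<Sum>A\<in>upper_parts L. below_root (cut L A))"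
  proof (rule sum.cong[OF refl])
    fix A assume "A \<in> upper_parts L"
    then have A: "A \<subseteq> vertices L" "v \<notin> A" using d by (auto simp: upper_parts_def)
    have "restrict_forest (insert v (vertices L) - A) L = restrict_forest (vertices L - A) L"
      using d by (intro restrict_forest_cong) auto
    then show "cut {#LNode v L#} A = below_root (cut L A)"
      using A by (simp add: cut_def below_root_def)
  qed
  also have "\<dots> = below_root (\<Sum>A\<in>upper_parts L. cut L A)"
    by (simp add: below_root_def linear_extension_sum)
  finally show ?case by (simp add: node.IH[OF d(1)] cut_forest_simps)
next
  case (union L M)
  note d = distinctly_labelled_union[OF union.prems]
  have "(\<Sum>A\<in>upper_parts (L + M). cut (L + M) A) =
      (\<Sum>(A, B)\<in>upper_parts L \<times> upper_parts M. cut (L + M) (A \<union> B))"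
    by (subst sum.reindex_bij_betw[OF upper_parts_union[OF d(3)], symmetric])
      (simp add: case_prod_beta)
  also have "\<dots> = (\<Sum>(A, B)\<in>upper_parts L \<times> upper_parts M. cut L A * cut M B)"
  proof (rule sum.cong[OF refl], clarify)
    fix A B assume "A \<in> upper_parts L" "B \<in> upper_parts M"
    then have "A \<subseteq> vertices L" "B \<subseteq> vertices M" by (auto simp: upper_parts_def)
    then have "restrict_forest (A \<union> B) L = restrict_forest A L"
      "restrict_forest (A \<union> B) M = restrict_forest B M"
      "restrict_forest (vertices L \<union> vertices M - (A \<union> B)) L = restrict_forest (vertices L - A) L"
      "restrict_forest (vertices L \<union> vertices M - (A \<union> B)) M = restrict_forest (vertices M - B) M"
      using d(3) by (auto intro!: restrict_forest_cong)
    then show "cut (L + M) (A \<union> B) = cut L A * cut M B"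
      by (simp add: cut_def basis_mult)
  qed
  also have "\<dots> = (\<Sum>A\<in>upper_parts L. cut L A) * (\<Sum>B\<in>upper_parts M. cut M B)"
    by (simp add: sum_product sum.cartesian_product)
  finally show ?case using union.IH d by (simp add: cut_forest_simps)
qed

lemma coproduct_forest_eq: "coproduct_forest F = cut_forest F"
proof -
  have "coproduct_forest F = (\<Sum>A\<in>upper_parts (labelling F). cut (labelling F) A)"
    by (simp add: coproduct_forest_def Let_def descendant_closed_iff upper_parts_def cut_def)
  then show ?thesis using sum_cuts[OF labelling(1)[of F]] labelling(2) by simp
qed

lemmas coproduct_forest_simps = cut_forest_simps[folded coproduct_forest_eq]

subsection \<open>Grafting\<close>

definition join_root :: "HCK \<Rightarrow> HCK" where
  "join_root = linear_extension (\<lambda>F. basis {#Node F#})"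

text \<open>
  The sum over all vertices of a tree of the graftings onto this vertex. The root contributes the
  tree with children \<open>F + G\<close>, a vertex in a child \<open>t\<close> changes this child only. The recursion runs over
  the pairs \<open>(t, graft_all_tree F t)\<close> because the unchanged children \<open>G - {#t#}\<close> are needed as well.
\<close>

primrec graft_all_tree :: "forest \<Rightarrow> tree \<Rightarrow> HCK" where
  "graft_all_tree F (Node G) = join_root (basis (F + G) +
     (\<Sum>(t, x) \<in># image_mset (\<lambda>t. (t, graft_all_tree F t)) G. x * basis (G - {#t#})))"

definition graft_all :: "forest \<Rightarrow> forest \<Rightarrow> HCK" where
  "graft_all F G = (\<Sum>t \<in># G. graft_all_tree F t * basis (G - {#t#}))"

text \<open>
  Grafting is a derivation for the disjoint union, since a vertex of \<open>G + H\<close> lies in exactly one of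
  the two parts.
\<close>

lemma graft_all_simps:
  "graft_all F {#} = 0"
  "graft_all F {#Node G#} = join_root (basis (F + G) + graft_all F G)"
  "graft_all F (G + H) = graft_all F G * basis H + basis G * graft_all F H"
proof -
  have *: "(\<Sum>t \<in># G. graft_all_tree F t * basis (G + H - {#t#})) = graft_all F G * basis H" for G H
  proof -
    have "(\<Sum>t \<in># G. graft_all_tree F t * basis (G + H - {#t#})) =
        (\<Sum>t \<in># G. graft_all_tree F t * basis (G - {#t#}) * basis H)"
      by (rule arg_cong[where f = sum_mset], rule image_mset_cong)
        (simp add: basis_mult mult.assoc)
    then show ?thesis by (simp add: graft_all_def sum_mset_distrib_right)
  qed
  show "graft_all F (G + H) = graft_all F G * basis H + basis G * graft_all F H"
    using *[of G H] *[of H G] by (simp add: graft_all_def[of F "G + H"] add.commute mult.commute)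
qed (simp_all add: graft_all_def multiset.map_comp o_def)

lemma graft_forest_outside: "u \<notin> vertices L \<Longrightarrow> graft_forest F u L = shape_forest L"
  by (induction L rule: lforest_induct) auto

lemma sum_graftings:
  "distinctly_labelled L \<Longrightarrow> (\<Sum>v\<in>vertices L. basis (graft_forest F v L)) = graft_all F (shape_forest L)"
proof (induction L rule: lforest_induct)
  case empty
  then show ?case by (simp add: graft_all_simps)
next
  case (node v L)
  note d = distinctly_labelled_node[OF node.prems]
  have "(\<Sum>u\<in>vertices {#LNode v L#}. basis (graft_forest F u {#LNode v L#})) =
      basis {#Node (shape_forest L + F)#} + (\<Sum>u\<in>vertices L. basis {#Node (graft_forest F u L)#})"
    using d by (auto simp: graft_forest_outside intro!: sum.cong)
  also have "(\<Sum>u\<in>vertices L. basis {#Node (graft_forest F u L)#}) =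
      join_root (\<Sum>u\<in>vertices L. basis (graft_forest F u L))"
    by (simp add: join_root_def linear_extension_sum)
  finally show ?case
    by (simp add: node.IH[OF d(1)] graft_all_simps join_root_def linear_extension_add add.commute)
next
  case (union L M)
  note d = distinctly_labelled_union[OF union.prems]
  have "(\<Sum>u\<in>vertices (L + M). basis (graft_forest F u (L + M))) =
      (\<Sum>u\<in>vertices L. basis (graft_forest F u (L + M))) +
      (\<Sum>u\<in>vertices M. basis (graft_forest F u (L + M)))"
    using d(3) by (simp add: sum.union_disjoint)
  also have "(\<Sum>u\<in>vertices L. basis (graft_forest F u (L + M))) =
      (\<Sum>u\<in>vertices L. basis (graft_forest F u L)) * basis (shape_forest M)"
    using d(3) unfolding sum_distrib_right
    by (intro sum.cong refl) (auto simp: basis_mult graft_forest_outside disjoint_iff)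
  also have "(\<Sum>u\<in>vertices M. basis (graft_forest F u (L + M))) =
      basis (shape_forest L) * (\<Sum>u\<in>vertices M. basis (graft_forest F u M))"
    using d(3) unfolding sum_distrib_left
    by (intro sum.cong refl) (metis IntI basis_mult empty_iff graft_forest_outside graft_forest_simps(3))
  finally show ?case using union.IH d by (simp add: graft_all_simps)
qed

lemma growth_forest_eq:
  "growth_forest F G = (if G = {#} then basis F else (1 / real (weight G)) *\<^sub>R graft_all F G)"
  using sum_graftings[OF labelling(1)[of G]] by (simp add: growth_forest_def Let_def labelling(2))

section \<open>The Hopf algebra axioms\<close>

lemma linear_below_root [linears]: "linear f \<Longrightarrow> linear (\<lambda>x. below_root (f x))"
  unfolding below_root_def by (intro linears)

lemma linear_join_root [linears]: "linear f \<Longrightarrow> linear (\<lambda>x. join_root (f x))"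
  unfolding join_root_def by (intro linears)

lemma below_root_basis [simp]: "below_root (basis (F, G)) = basis (F, {#Node G#})"
  by (simp add: below_root_def)

lemma join_root_basis [simp]: "join_root (basis F) = basis {#Node F#}"
  by (simp add: join_root_def)

lemma tensor_basis_left [simp]: "tensor (basis F) 1 = basis (F, {#})"
  and tensor_basis_right [simp]: "tensor 1 (basis F) = basis ({#}, F)" for F :: forest
  using tensor_basis[of F "{#}"] tensor_basis[of "{#}" F] by simp_all

lemma coproduct_join_root: "coproduct (join_root x) = tensor (join_root x) 1 + below_root (coproduct x)"
  by (rule linear_eq_on_basis) (auto intro!: linears simp: coproduct_basis coproduct_forest_simps)

subsection \<open>Counit and grading\<close>

lemma counit_left:
  "linear_extension (\<lambda>(A, B). if A = {#} then basis B else 0) (coproduct_forest F) = basis F"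
proof (induction F rule: forest_induct)
  case (node F)
  have "linear_extension (\<lambda>(A, B). if A = {#} then basis B else 0) (below_root z) =
      join_root (linear_extension (\<lambda>(A, B). if A = {#} then basis B else 0) z)" for z
  proof (rule linear_eq_on_basis[where x = z])
    show "linear_extension (\<lambda>(A, B). if A = {#} then basis B else 0) (below_root (basis p)) =
      join_root (linear_extension (\<lambda>(A, B). if A = {#} then basis B else 0) (basis p))" for p
      by (cases p) (auto simp: join_root_def)
  qed (intro linears)+
  then show ?case
    by (simp add: coproduct_forest_simps linear_extension_add node.IH)
next
  case (union F G)
  have "linear_extension (\<lambda>(A, B). if A = {#} then basis B else 0) (x * y) =
      linear_extension (\<lambda>(A, B). if A = {#} then basis B else 0) x *
      linear_extension (\<lambda>(A, B). if A = {#} then basis B else (0::HCK)) y" for x y :: HCK2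
    by (rule linear_extension_times) (auto simp: basis_mult)
  then show ?case by (simp only: coproduct_forest_simps union.IH basis_mult)
qed (simp add: coproduct_forest_simps flip: basis_empty_pair)

lemma counit_right:
  "linear_extension (\<lambda>(A, B). if B = {#} then basis A else 0) (coproduct_forest F) = basis F"
proof (induction F rule: forest_induct)
  case (node F)
  have "linear_extension (\<lambda>(A, B). if B = {#} then basis A else 0) (below_root z) = (0::HCK)" for z
  proof (rule linear_eq_on_basis[where x = z])
    show "linear_extension (\<lambda>(A, B). if B = {#} then basis A else 0) (below_root (basis p)) = (0::HCK)"
      for p by (cases p) auto
  qed (intro linears)+
  then show ?case
    by (simp add: coproduct_forest_simps linear_extension_add)
next
  case (union F G)
  have "linear_extension (\<lambda>(A, B). if B = {#} then basis A else 0) (x * y) =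
      linear_extension (\<lambda>(A, B). if B = {#} then basis A else 0) x *
      linear_extension (\<lambda>(A, B). if B = {#} then basis A else (0::HCK)) y" for x y :: HCK2
    by (rule linear_extension_times) (auto simp: basis_mult)
  then show ?case by (simp only: coproduct_forest_simps union.IH basis_mult)
qed (simp add: coproduct_forest_simps flip: basis_empty_pair)

text \<open>
  The counit axioms enter through sums over the coproduct that are supported on the cuts with one
  empty part.
\<close>

lemma counit_left_apply:
  "linear_extension (\<lambda>(A, B). if A = {#} then \<phi> B else 0) (coproduct_forest F) = \<phi> F"
proof -
  let ?E = "(\<lambda>(A, B). if A = {#} then basis B else 0) :: forest \<times> forest \<Rightarrow> HCK"
  have "(\<lambda>(A, B). if A = {#} then \<phi> B else 0) = (\<lambda>p. linear_extension \<phi> (?E p))"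
    by auto
  then have "linear_extension (\<lambda>(A, B). if A = {#} then \<phi> B else 0) (coproduct_forest F) =
      linear_extension \<phi> (linear_extension ?E (coproduct_forest F))"
    by (simp only: linear_image_linear_extension[OF linear_linear_extension])
  then show ?thesis by (simp only: counit_left linear_extension_basis)
qed

lemma counit_right_apply:
  "linear_extension (\<lambda>(A, B). if B = {#} then \<phi> A else 0) (coproduct_forest F) = \<phi> F"
proof -
  let ?E = "(\<lambda>(A, B). if B = {#} then basis A else 0) :: forest \<times> forest \<Rightarrow> HCK"
  have "(\<lambda>(A, B). if B = {#} then \<phi> A else 0) = (\<lambda>p. linear_extension \<phi> (?E p))"
    by auto
  then have "linear_extension (\<lambda>(A, B). if B = {#} then \<phi> A else 0) (coproduct_forest F) =
      linear_extension \<phi> (linear_extension ?E (coproduct_forest F))"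
    by (simp only: linear_image_linear_extension[OF linear_linear_extension])
  then show ?thesis by (simp only: counit_right linear_extension_basis)
qed

text \<open>
  The weight in the denominator of the natural growth is controlled by the grading, and the
  recursions over cuts terminate because of it.
\<close>

lemma coproduct_graded:
  "(A, B) \<in> Poly_Mapping.keys (coproduct_forest F) \<Longrightarrow> weight A + weight B = weight F"
proof (induction F arbitrary: A B rule: forest_induct)
  case empty
  then show ?case by (simp add: coproduct_forest_simps flip: basis_empty_pair)
next
  case (node F)
  have "Poly_Mapping.keys (below_root (coproduct_forest F)) \<subseteq>
      (\<lambda>(A, B). (A, {#Node B#})) ` Poly_Mapping.keys (coproduct_forest F)"
    unfolding below_root_def by (rule order_trans[OF keys_linear_extension]) auto
  then have "(A, B) = ({#Node F#}, {#}) \<or>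
      (\<exists>C. (A, C) \<in> Poly_Mapping.keys (coproduct_forest F) \<and> B = {#Node C#})"
    using node.prems Poly_Mapping.keys_add[of "basis ({#Node F#}, {#})" "below_root (coproduct_forest F)"]
    unfolding coproduct_forest_simps by auto
  then show ?case by (auto dest: node.IH)
next
  case (union F G)
  obtain p q where "(A, B) = p + q" "p \<in> Poly_Mapping.keys (coproduct_forest F)"
    "q \<in> Poly_Mapping.keys (coproduct_forest G)"
    using union.prems keys_mult[of "coproduct_forest F" "coproduct_forest G"]
    by (auto simp: coproduct_forest_simps)
  then show ?case using union.IH[of "fst p" "snd p"] union.IH(2)[of "fst q" "snd q"]
    by (cases p; cases q) auto
qed

subsection \<open>Coassociativity\<close>

type_synonym HCK3 = "(forest \<times> forest \<times> forest) \<Rightarrow>\<^sub>0 real"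

text \<open>
  The maps \<open>\<Delta> \<otimes> id\<close> and \<open>id \<otimes> \<Delta>\<close>.
\<close>

definition coproduct_left :: "HCK2 \<Rightarrow> HCK3" where
  "coproduct_left = linear_extension (\<lambda>(F, G).
     linear_extension (\<lambda>(A, B). basis (A, B, G)) (coproduct_forest F))"

definition coproduct_right :: "HCK2 \<Rightarrow> HCK3" where
  "coproduct_right = linear_extension (\<lambda>(F, G).
     linear_extension (\<lambda>(A, B). basis (F, A, B)) (coproduct_forest G))"

lemma linear_coproduct_sides [linears]:
  "linear f \<Longrightarrow> linear (\<lambda>x. coproduct_left (f x))" "linear f \<Longrightarrow> linear (\<lambda>x. coproduct_right (f x))"
  unfolding coproduct_left_def coproduct_right_def by (intro linears; assumption)+

lemma coproduct_left_mult: "coproduct_left (x * y) = coproduct_left x * coproduct_left y"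
  unfolding coproduct_left_def
proof (rule linear_extension_times, clarify)
  fix F G F' G' :: forest
  have "linear_extension (\<lambda>(A, B). basis (A, B, G + G')) (x * y) =
      linear_extension (\<lambda>(A, B). basis (A, B, G)) x * linear_extension (\<lambda>(A, B). basis (A, B, G')) y"
    for x y :: HCK2
    by (rule linear_extension_times) (auto simp: basis_mult)
  then show "(case (F, G) + (F', G') of (F, G) \<Rightarrow>
       linear_extension (\<lambda>(A, B). basis (A, B, G)) (coproduct_forest F)) =
     linear_extension (\<lambda>(A, B). basis (A, B, G)) (coproduct_forest F) *
     linear_extension (\<lambda>(A, B). basis (A, B, G')) (coproduct_forest F')"
    by (simp add: coproduct_forest_simps)
qed

lemma coproduct_right_mult: "coproduct_right (x * y) = coproduct_right x * coproduct_right y"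
  unfolding coproduct_right_def
proof (rule linear_extension_times, clarify)
  fix F G F' G' :: forest
  have "linear_extension (\<lambda>(A, B). basis (F + F', A, B)) (x * y) =
      linear_extension (\<lambda>(A, B). basis (F, A, B)) x * linear_extension (\<lambda>(A, B). basis (F', A, B)) y"
    for x y :: HCK2
    by (rule linear_extension_times) (auto simp: basis_mult)
  then show "(case (F, G) + (F', G') of (F, G) \<Rightarrow>
       linear_extension (\<lambda>(A, B). basis (F, A, B)) (coproduct_forest G)) =
     linear_extension (\<lambda>(A, B). basis (F, A, B)) (coproduct_forest G) *
     linear_extension (\<lambda>(A, B). basis (F', A, B)) (coproduct_forest G')"
    by (simp add: coproduct_forest_simps)
qed

text \<open>
  On a tree \<open>[F]\<close> both sides are the trivial cut, a term from the coproduct of \<open>F\<close> with one empty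
  factor, and the double coproduct of \<open>F\<close> with the root added to the last factor.
\<close>

lemma coassociative: "coproduct_left (coproduct_forest F) = coproduct_right (coproduct_forest F)"
proof (induction F rule: forest_induct)
  case empty
  show ?case
    by (simp add: coproduct_forest_simps coproduct_left_def coproduct_right_def flip: basis_empty_pair)
next
  case (node F)
  define below :: "HCK3 \<Rightarrow> HCK3"
    where "below = linear_extension (\<lambda>(A, B, C). basis (A, B, {#Node C#}))"
  have [linears]: "linear f \<Longrightarrow> linear (\<lambda>x. below (f x))" for f :: "HCK2 \<Rightarrow> HCK3"
    unfolding below_def by (intro linears)
  \<comment> \<open>In \<open>middle\<close> the upper part of a cut of \<open>F\<close> is the first factor, and the rest with the root the second one.\<close>
  define middle :: "HCK2 \<Rightarrow> HCK3"
    where "middle = linear_extension (\<lambda>(A, B). basis (A, {#Node B#}, {#}))"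
  have [linears]: "linear f \<Longrightarrow> linear (\<lambda>x. middle (f x))" for f :: "HCK2 \<Rightarrow> HCK2"
    unfolding middle_def by (intro linears)
  have left_root: "linear_extension (\<lambda>(A, B). basis (A, B, {#})) (below_root z) = middle z" for z
  proof (rule linear_eq_on_basis[where x = z])
    show "linear_extension (\<lambda>(A, B). basis (A, B, {#})) (below_root (basis p)) = middle (basis p)" for p
      by (cases p) (simp add: middle_def)
  qed (intro linears)+
  have left: "coproduct_left (below_root z) = below (coproduct_left z)" for z
  proof (rule linear_eq_on_basis[where x = z])
    fix p :: "forest \<times> forest"
    obtain A B where p: "p = (A, B)" by fastforce
    have "linear_extension (\<lambda>(C, D). basis (C, D, {#Node B#})) y =
        below (linear_extension (\<lambda>(C, D). basis (C, D, B)) y)" for y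
    proof (rule linear_eq_on_basis[where x = y])
      show "linear_extension (\<lambda>(C, D). basis (C, D, {#Node B#})) (basis q) =
        below (linear_extension (\<lambda>(C, D). basis (C, D, B)) (basis q))" for q
        by (cases q) (simp add: below_def)
    qed (intro linears)+
    then show "coproduct_left (below_root (basis p)) = below (coproduct_left (basis p))"
      by (simp add: p coproduct_left_def)
  qed (intro linears)+
  have right: "coproduct_right (below_root z) = middle z + below (coproduct_right z)" for z
  proof (rule linear_eq_on_basis[where x = z])
    fix p :: "forest \<times> forest"
    obtain A B where p: "p = (A, B)" by fastforce
    have "linear_extension (\<lambda>(C, D). basis (A, C, D)) (below_root y) =
        below (linear_extension (\<lambda>(C, D). basis (A, C, D)) y)" for y
    proof (rule linear_eq_on_basis[where x = y])
      show "linear_extension (\<lambda>(C, D). basis (A, C, D)) (below_root (basis q)) =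
        below (linear_extension (\<lambda>(C, D). basis (A, C, D)) (basis q))" for q
        by (cases q) (simp add: below_def)
    qed (intro linears)+
    then show "coproduct_right (below_root (basis p)) = middle (basis p) + below (coproduct_right (basis p))"
      by (simp add: p coproduct_right_def middle_def coproduct_forest_simps linear_extension_add)
  qed (intro linears)+
  have "coproduct_left (coproduct_forest {#Node F#}) =
      basis ({#Node F#}, {#}, {#}) + middle (coproduct_forest F) + below (coproduct_left (coproduct_forest F))"
  proof -
    have "coproduct_left (coproduct_forest {#Node F#}) =
        coproduct_left (basis ({#Node F#}, {#})) + coproduct_left (below_root (coproduct_forest F))"
      by (simp add: coproduct_forest_simps coproduct_left_def linear_extension_add)
    also have "coproduct_left (basis ({#Node F#}, {#})) =
        basis ({#Node F#}, {#}, {#}) + middle (coproduct_forest F)"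
      by (simp add: coproduct_left_def coproduct_forest_simps linear_extension_add left_root)
    finally show ?thesis by (simp add: left)
  qed
  moreover have "coproduct_right (coproduct_forest {#Node F#}) =
      basis ({#Node F#}, {#}, {#}) + (middle (coproduct_forest F) + below (coproduct_right (coproduct_forest F)))"
  proof -
    have "coproduct_right (coproduct_forest {#Node F#}) =
        coproduct_right (basis ({#Node F#}, {#})) + coproduct_right (below_root (coproduct_forest F))"
      by (simp add: coproduct_forest_simps coproduct_right_def linear_extension_add)
    also have "coproduct_right (basis ({#Node F#}, {#})) = basis ({#Node F#}, {#}, {#})"
      by (simp add: coproduct_right_def coproduct_forest_simps flip: basis_empty_pair)
    finally show ?thesis by (simp add: right)
  qed
  ultimately show ?case using node.IH by (simp add: add.assoc)
next
  case (union F G)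
  then show ?case by (simp add: coproduct_forest_simps coproduct_left_mult coproduct_right_mult)
qed

lemma coassociative_apply:
  "linear_extension (\<lambda>(F, G). linear_extension (\<lambda>(A, B). \<theta> A B G) (coproduct_forest F)) (coproduct_forest H) =
   linear_extension (\<lambda>(F, G). linear_extension (\<lambda>(A, B). \<theta> F A B) (coproduct_forest G)) (coproduct_forest H)"
proof -
  let ?X = "linear_extension (\<lambda>(A, B, C). \<theta> A B C)"
  have "?X (coproduct_left z) =
      linear_extension (\<lambda>(F, G). linear_extension (\<lambda>(A, B). \<theta> A B G) (coproduct_forest F)) z" for z
    by (simp add: coproduct_left_def linear_image_linear_extension[OF linear_linear_extension] case_prod_unfold)
  moreover have "?X (coproduct_right z) =
      linear_extension (\<lambda>(F, G). linear_extension (\<lambda>(A, B). \<theta> F A B) (coproduct_forest G)) z" for z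
    by (simp add: coproduct_right_def linear_image_linear_extension[OF linear_linear_extension] case_prod_unfold)
  ultimately show ?thesis by (metis coassociative)
qed

section \<open>Natural growth and the coproduct\<close>

definition grafting :: "HCK \<Rightarrow> HCK \<Rightarrow> HCK" where
  "grafting = bilinear_extension graft_all"

lemma linear_grafting [linears]:
  "linear f \<Longrightarrow> linear (\<lambda>x. grafting (f x) y)" "linear f \<Longrightarrow> linear (\<lambda>x. grafting y (f x))"
  unfolding grafting_def by (intro linears; assumption)+

lemma grafting_basis [simp]: "grafting (basis F) (basis G) = graft_all F G"
  by (simp add: grafting_def)

text \<open>
  If a cut of the forest \<open>G\<close> with \<open>F\<close> grafted onto \<open>v\<close> has \<open>v\<close> in its upper part, then all of \<open>F\<close> belongs
  to the upper part, and the cut is a cut of \<open>G\<close> with \<open>F\<close> grafted onto the upper part. Otherwise it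
  consists of independent cuts of \<open>F\<close> and \<open>G\<close>, and the lower part of \<open>F\<close> is grafted onto that of \<open>G\<close>.
  The operators \<open>graft_left\<close> and \<open>graft_right\<close> are these two contributions.
\<close>

definition graft_left :: "HCK \<Rightarrow> HCK2 \<Rightarrow> HCK2" where
  "graft_left = bilinear_extension (\<lambda>F (A, B). tensor (graft_all F A) (basis B))"

definition graft_right :: "HCK2 \<Rightarrow> HCK2 \<Rightarrow> HCK2" where
  "graft_right = bilinear_extension (\<lambda>(C, D) (A, B). tensor (basis (C + A)) (graft_all D B))"

lemma linear_graft_left [linears]:
  "linear f \<Longrightarrow> linear (\<lambda>x. graft_left (f x) y)" "linear g \<Longrightarrow> linear (\<lambda>x. graft_left z (g x))"
  unfolding graft_left_def by (intro linears; assumption)+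

lemma linear_graft_right [linears]:
  "linear f \<Longrightarrow> linear (\<lambda>x. graft_right (f x) y)" "linear g \<Longrightarrow> linear (\<lambda>x. graft_right z (g x))"
  unfolding graft_right_def by (intro linears; assumption)+

lemma graft_left_basis [simp]:
  "graft_left (basis F) (basis (A, B)) = tensor (graft_all F A) (basis B)"
  by (simp add: graft_left_def)

lemma graft_right_basis [simp]:
  "graft_right (basis (C, D)) (basis (A, B)) = tensor (basis (C + A)) (graft_all D B)"
  by (simp add: graft_right_def)

lemma tensor_add: "tensor (x + x') y = tensor x y + tensor x' y" "tensor x (y + y') = tensor x y + tensor x y'"
  by (rule linear_add[of "\<lambda>x. tensor x y"] linear_add[of "\<lambda>y. tensor x y"], intro linears)+

lemma tensor_0 [simp]: "tensor 0 y = 0" "tensor x 0 = 0"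
  by (rule linear_0[of "\<lambda>x. tensor x y"] linear_0[of "\<lambda>y. tensor x y"], intro linears)+

lemma tensor_basis_mult:
  "tensor (x * basis A) (basis (B + B')) = tensor x (basis B) * basis (A, B')"
  "tensor (basis A * x) (basis (B + B')) = basis (A, B) * tensor x (basis B')"
  "tensor (basis (C + C')) (y * basis B) = tensor (basis C) y * basis (C', B)"
  "tensor (basis (C + C')) (basis B * y) = basis (C, B) * tensor (basis C') y"
  for A B C :: forest
  by (simp_all add: tensor_mult basis_mult flip: tensor_basis)

lemma graft_left_mult:
  "graft_left (basis F) (z * w) = graft_left (basis F) z * w + z * graft_left (basis F) w"
proof (rule bilinear_eq_on_basis[where f = "\<lambda>z w. graft_left (basis F) (z * w)"])
  fix p q :: "forest \<times> forest"
  show "graft_left (basis F) (basis p * basis q) =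
      graft_left (basis F) (basis p) * basis q + basis p * graft_left (basis F) (basis q)"
    by (cases p; cases q) (simp add: basis_mult graft_all_simps tensor_add tensor_basis_mult)
qed (intro linears)+

lemma graft_right_mult: "graft_right u (z * w) = graft_right u z * w + z * graft_right u w"
proof (rule bilinear_eq_on_basis[where f = "\<lambda>z w. graft_right u (z * w)"])
  fix p q :: "forest \<times> forest"
  show "graft_right u (basis p * basis q) =
      graft_right u (basis p) * basis q + basis p * graft_right u (basis q)"
  proof (rule linear_eq_on_basis[where f = "\<lambda>u. graft_right u (basis p * basis q)"])
    fix r :: "forest \<times> forest"
    obtain A B A' B' C D where *: "p = (A, B)" "q = (A', B')" "r = (C, D)"
      by (metis surj_pair)
    have "tensor (basis (C + (A + A'))) (graft_all D B * basis B') =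
        tensor (basis (C + A)) (graft_all D B) * basis (A', B')"
      using tensor_basis_mult(3)[of "C + A" A'] by (simp add: add.assoc)
    moreover have "tensor (basis (C + (A + A'))) (basis B * graft_all D B') =
        basis (A, B) * tensor (basis (C + A')) (graft_all D B')"
      using tensor_basis_mult(4)[of A "C + A'"] by (simp add: add_ac)
    ultimately show "graft_right (basis r) (basis p * basis q) =
        graft_right (basis r) (basis p) * basis q + basis p * graft_right (basis r) (basis q)"
      by (simp add: * basis_mult graft_all_simps tensor_add)
  qed (intro linears)+
qed (intro linears)+

lemma below_root_tensor: "below_root (tensor x y) = tensor x (join_root y)"
  by (rule bilinear_eq_on_basis[where f = "\<lambda>x y. below_root (tensor x y)"])
    ((intro linears)+, simp add: tensor_basis)

lemma coproduct_add: "coproduct (x + y) = coproduct x + coproduct y"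
  by (rule linear_add) (intro linears)

lemma below_root_add: "below_root (x + y) = below_root x + below_root y"
  by (rule linear_add) (intro linears)

lemma join_root_add: "join_root (x + y) = join_root x + join_root y"
  by (rule linear_add) (intro linears)

text \<open>
  Both sides are derivations in \<open>G\<close> with respect to the disjoint union, over the multiplicative
  coproduct. On a tree the term in which \<open>F\<close> is grafted onto the root yields the product of the
  coproducts of \<open>F\<close> and \<open>G\<close>, which is the part of \<open>graft_right\<close> in which the lower part of \<open>F\<close> is
  grafted onto the root.
\<close>

lemma coproduct_graft_all:
  "coproduct (graft_all F G) =
     graft_left (basis F) (coproduct_forest G) + graft_right (coproduct_forest F) (coproduct_forest G)"
proof (induction G rule: forest_induct)
  case empty
  have "graft_right u 1 = 0" for u
  proof (rule linear_eq_on_basis[where x = u and g = "\<lambda>_. 0"])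
    show "graft_right (basis p) 1 = 0" for p
      by (cases p) (simp add: graft_all_simps flip: basis_empty_pair)
  qed (intro linears)+
  moreover have "graft_left (basis F) 1 = 0"
    by (simp add: graft_all_simps flip: basis_empty_pair)
  ultimately show ?case
    by (simp add: graft_all_simps coproduct_forest_simps coproduct_def)
next
  case (node G)
  have left: "graft_left (basis F) (below_root z) = below_root (graft_left (basis F) z)" for z
  proof (rule linear_eq_on_basis[where x = z])
    show "graft_left (basis F) (below_root (basis p)) = below_root (graft_left (basis F) (basis p))" for p
      by (cases p) (simp add: below_root_tensor)
  qed (intro linears)+
  have right: "graft_right u (below_root z) = below_root (u * z) + below_root (graft_right u z)" for u z
  proof (rule bilinear_eq_on_basis[where f = "\<lambda>u z. graft_right u (below_root z)"])
    fix p q :: "forest \<times> forest"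
    show "graft_right (basis p) (below_root (basis q)) =
        below_root (basis p * basis q) + below_root (graft_right (basis p) (basis q))"
      by (cases p; cases q)
        (simp add: basis_mult graft_all_simps below_root_tensor join_root_add tensor_add tensor_basis)
  qed (intro linears)+
  have right_root: "graft_right u (basis ({#Node G#}, {#})) = 0" for u
  proof (rule linear_eq_on_basis[where x = u and g = "\<lambda>_. 0"])
    show "graft_right (basis p) (basis ({#Node G#}, {#})) = 0" for p
      by (cases p) (simp add: graft_all_simps)
  qed (intro linears)+
  have "coproduct (graft_all F {#Node G#}) =
      tensor (graft_all F {#Node G#}) 1 + below_root (coproduct (basis (F + G) + graft_all F G))"
    by (simp add: graft_all_simps coproduct_join_root)
  also have "coproduct (basis (F + G) + graft_all F G) =
      coproduct_forest F * coproduct_forest G + graft_left (basis F) (coproduct_forest G) +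
      graft_right (coproduct_forest F) (coproduct_forest G)"
    by (simp add: coproduct_add coproduct_basis coproduct_forest_simps node.IH)
  finally show ?case
    using linear_add[OF linear_graft_left(2)[OF linear_id']] linear_add[OF linear_graft_right(2)[OF linear_id']]
    by (simp add: coproduct_forest_simps left right right_root below_root_add)
next
  case (union G H)
  have mult: "coproduct (x * y) = coproduct x * coproduct y" for x y
    unfolding coproduct_def by (rule linear_extension_times) (simp add: coproduct_forest_simps)
  show ?case
    by (simp add: graft_all_simps coproduct_add mult union.IH coproduct_basis coproduct_forest_simps
        graft_left_mult graft_right_mult algebra_simps)
qed

lemma coproduct_grafting:
  "coproduct (grafting x y) = graft_left x (coproduct y) + graft_right (coproduct x) (coproduct y)"
  by (rule bilinear_eq_on_basis[where f = "\<lambda>x y. coproduct (grafting x y)"])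
    ((intro linears)+, simp add: coproduct_basis coproduct_graft_all)

subsection \<open>Primitive elements\<close>

lemma counit_left_linear:
  "linear_extension (\<lambda>(A, B). if A = {#} then \<phi> B else 0) (coproduct x) = linear_extension \<phi> x"
  by (rule linear_eq_on_basis[where f = "\<lambda>x. linear_extension _ (coproduct x)"])
    ((intro linears)+, simp add: coproduct_basis counit_left_apply)

lemma counit_right_linear:
  "linear_extension (\<lambda>(A, B). if B = {#} then \<phi> A else 0) (coproduct x) = linear_extension \<phi> x"
  by (rule linear_eq_on_basis[where f = "\<lambda>x. linear_extension _ (coproduct x)"])
    ((intro linears)+, simp add: coproduct_basis counit_right_apply)

text \<open>
  Sums over the coproduct of a primitive element, or of a word, are sums over pure tensors.
\<close>

lemma linear_extension_tensor:
  assumes "\<And>A B. \<theta> (A, B) = T (basis A) (basis B)" "\<And>y. linear (\<lambda>x. T x y)" "\<And>x. linear (T x)"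
  shows "linear_extension \<theta> (tensor x y) = T x y"
  by (rule bilinear_eq_on_basis[where f = "\<lambda>x y. linear_extension \<theta> (tensor x y)"])
    (use assms in \<open>auto intro!: linears simp: tensor_basis\<close>)

lemma primitive_counit:
  assumes "p \<in> primitives"
  shows "Poly_Mapping.lookup p {#} = 0"
proof -
  let ?E = "linear_extension (\<lambda>(A, B). if A = {#} then basis B else 0) :: HCK2 \<Rightarrow> HCK"
  have "?E (tensor x y) = Poly_Mapping.lookup x {#} *\<^sub>R y" for x y
    by (rule linear_extension_tensor) (auto intro!: linears simp: lookup_basis)
  then have "?E (tensor p 1 + tensor 1 p) = Poly_Mapping.lookup p {#} *\<^sub>R 1 + p"
    by (simp add: linear_extension_add lookup_basis flip: basis_empty)
  moreover have "?E (coproduct p) = p"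
    by (simp add: counit_left_linear linear_extension_expand)
  ultimately have "Poly_Mapping.lookup p {#} *\<^sub>R (1::HCK) = 0"
    using assms by (simp add: primitives_def)
  then show ?thesis by simp
qed

text \<open>
  Division of every homogeneous component by its degree; the empty forest has weight \<open>0\<close> and is sent
  to \<open>0\<close>. It turns the natural growth, which divides by the number of vertices, into the sum of all
  graftings.
\<close>

definition inverse_weight :: "HCK \<Rightarrow> HCK" where
  "inverse_weight = linear_extension (\<lambda>F. (1 / real (weight F)) *\<^sub>R basis F)"

lemma linear_inverse_weight [linears]: "linear f \<Longrightarrow> linear (\<lambda>x. inverse_weight (f x))"
  unfolding inverse_weight_def by (intro linears)

text \<open>
  The first summand comes from the convention \<open>f \<top> 1 = f\<close>; nothing can be grafted onto the empty
  forest.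
\<close>

lemma growth_eq_grafting: "x \<top> y = Poly_Mapping.lookup y {#} *\<^sub>R x + grafting x (inverse_weight y)"
proof (rule bilinear_eq_on_basis[where f = "\<lambda>x y. x \<top> y"])
  show "basis F \<top> basis G = Poly_Mapping.lookup (basis G) {#} *\<^sub>R basis F +
      grafting (basis F) (inverse_weight (basis G))" for F G
    using linear_scale[OF linear_grafting(2)[OF linear_id'], of "basis F"]
    by (auto simp: growth_basis growth_forest_eq lookup_basis inverse_weight_def graft_all_simps)
qed (intro linears)+

text \<open>
  The coproduct preserves the total weight, so dividing by the weight commutes with it. This treats
  inhomogeneous primitive elements without splitting them into components.
\<close>

lemma inverse_weight_primitive:
  assumes "p \<in> primitives"
  shows "inverse_weight p \<in> primitives"
proof -
  let ?M = "linear_extension (\<lambda>(A, B). (1 / real (weight A + weight B)) *\<^sub>R basis (A, B)) :: HCK2 \<Rightarrow> HCK2"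
  have "coproduct (inverse_weight x) = ?M (coproduct x)" for x
  proof (rule linear_eq_on_basis[where x = x])
    fix F
    have "?M (coproduct_forest F) =
        linear_extension (\<lambda>p. (1 / real (weight F)) *\<^sub>R basis p) (coproduct_forest F)"
      by (rule linear_extension_cong) (auto dest!: coproduct_graded)
    also have "\<dots> = (1 / real (weight F)) *\<^sub>R coproduct_forest F"
      unfolding linear_extension_fun_scaleR linear_extension_expand ..
    finally show "coproduct (inverse_weight (basis F)) = ?M (coproduct (basis F))"
      using linear_scale[OF linear_coproduct[OF linear_id']]
      by (simp add: inverse_weight_def coproduct_basis)
  qed (intro linears)+
  moreover have "?M (tensor x 1) = tensor (inverse_weight x) 1" for x
    by (rule linear_eq_on_basis[where f = "\<lambda>x. ?M (tensor x 1)"])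
      ((intro linears)+, simp add: inverse_weight_def linear_scale[OF linear_tensor(1)[OF linear_id']])
  moreover have "?M (tensor 1 x) = tensor 1 (inverse_weight x)" for x
    by (rule linear_eq_on_basis[where f = "\<lambda>x. ?M (tensor 1 x)"])
      ((intro linears)+, simp add: inverse_weight_def linear_scale[OF linear_tensor(2)[OF linear_id']])
  ultimately show ?thesis using assms by (simp add: primitives_def linear_extension_add)
qed

text \<open>
  For \<open>q = inverse_weight p\<close>, which is primitive, the coproduct of the grafting of \<open>x\<close> onto \<open>q\<close> has the
  two contributions \<open>graft_left\<close> and \<open>graft_right\<close>. Nothing can be grafted onto the empty forest,
  so the first one only sees \<open>q \<otimes> 1\<close> and the second one only \<open>1 \<otimes> q\<close>.
\<close>

lemma coproduct_growth:
  assumes "p \<in> primitives"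
  shows "coproduct (x \<top> p) =
    tensor (x \<top> p) 1 + linear_extension (\<lambda>(A, B). tensor (basis A) (basis B \<top> p)) (coproduct x)"
proof -
  let ?q = "inverse_weight p"
  have growth: "y \<top> p = grafting y ?q" for y
    using primitive_counit[OF assms] by (simp add: growth_eq_grafting)
  have "graft_left x (tensor ?q 1) = tensor (grafting x ?q) 1" for x
    by (rule bilinear_eq_on_basis[where f = "\<lambda>x q. graft_left x (tensor q 1)"]) ((intro linears)+, simp)
  moreover have "graft_left x (tensor 1 ?q) = 0" for x
    by (rule bilinear_eq_on_basis[where f = "\<lambda>x q. graft_left x (tensor 1 q)" and g = "\<lambda>_ _. 0"])
      ((intro linears)+, simp add: graft_all_simps)
  moreover have "graft_right z (tensor ?q 1) = 0" for z
  proof (rule bilinear_eq_on_basis[where f = "\<lambda>z q. graft_right z (tensor q 1)" and g = "\<lambda>_ _. 0"])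
    show "graft_right (basis p) (tensor (basis F) 1) = 0" for p F
      by (cases p) (simp add: graft_all_simps)
  qed (intro linears)+
  moreover have "graft_right z (tensor 1 ?q) =
      linear_extension (\<lambda>(A, B). tensor (basis A) (grafting (basis B) ?q)) z" for z
  proof (rule bilinear_eq_on_basis[where f = "\<lambda>z q. graft_right z (tensor 1 q)"])
    show "graft_right (basis p) (tensor 1 (basis F)) =
        linear_extension (\<lambda>(A, B). tensor (basis A) (grafting (basis B) (basis F))) (basis p)" for p F
      by (cases p) simp
  qed (intro linears)+
  moreover have "coproduct ?q = tensor ?q 1 + tensor 1 ?q"
    using inverse_weight_primitive[OF assms] by (simp add: primitives_def)
  ultimately show ?thesis
    using linear_add[OF linear_graft_left(2)[OF linear_id']] linear_add[OF linear_graft_right(2)[OF linear_id']]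
    by (simp add: growth coproduct_grafting)
qed

lemma graft_all_empty_left: "graft_all {#} G = real (weight G) *\<^sub>R basis G"
proof (induction G rule: forest_induct)
  case (node G)
  then show ?case
    using linear_scale[OF linear_join_root[OF linear_id']]
    by (simp add: graft_all_simps join_root_add scaleR_add_left)
qed (simp_all add: graft_all_simps mult_scaleR basis_mult scaleR_add_left)

lemma growth_one_left: "1 \<top> x = x"
  by (rule linear_eq_on_basis[where f = "\<lambda>x. 1 \<top> x"])
    ((intro linears)+, auto simp: growth_basis growth_forest_eq graft_all_empty_left simp flip: basis_empty)

text \<open>
  A tree other than \<open>Node {#}\<close> has an edge, and grafting a non-empty forest creates one.
\<close>

lemma keys_graft_all:
  "H \<in> Poly_Mapping.keys (graft_all F G) \<Longrightarrow> H \<noteq> {#} \<and> (F \<noteq> {#} \<longrightarrow> (\<exists>t\<in>#H. t \<noteq> Node {#}))"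
proof (induction G arbitrary: H rule: forest_induct)
  case empty
  then show ?case by (simp add: graft_all_simps)
next
  case (node G)
  obtain K where K: "H = {#Node K#}" "K \<in> Poly_Mapping.keys (basis (F + G) + graft_all F G)"
    using node.prems keys_linear_extension[of "\<lambda>F. basis {#Node F#}" "basis (F + G) + graft_all F G"]
    by (auto simp: graft_all_simps join_root_def)
  then have "K = F + G \<or> K \<in> Poly_Mapping.keys (graft_all F G)"
    using Poly_Mapping.keys_add[of "basis (F + G)" "graft_all F G"] by auto
  then show ?case using node.IH[of K] K by auto
next
  case (union G G')
  have "H \<in> Poly_Mapping.keys (graft_all F G * basis G') \<union> Poly_Mapping.keys (basis G * graft_all F G')"
    using union.prems Poly_Mapping.keys_add by (fastforce simp: graft_all_simps)
  then consider K where "H = K + G'" "K \<in> Poly_Mapping.keys (graft_all F G)"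
    | K where "H = G + K" "K \<in> Poly_Mapping.keys (graft_all F G')"
    using keys_mult[of "graft_all F G" "basis G'"] keys_mult[of "basis G" "graft_all F G'"] by auto
  then show ?case by cases (use union.IH in fastforce)+
qed

lemma counit_growth:
  "Poly_Mapping.lookup (x \<top> y) {#} = Poly_Mapping.lookup x {#} * Poly_Mapping.lookup y {#}"
proof -
  have "Poly_Mapping.lookup (graft_all F G) {#} = 0" for F G
    using keys_graft_all[of "{#}" F G] by (auto simp: in_keys_iff)
  then have "Poly_Mapping.lookup (grafting u v) {#} = 0" for u v
    by (rule_tac bilinear_eq_on_basis[where f = "\<lambda>u v. Poly_Mapping.lookup (grafting u v) {#}" and g = "\<lambda>_ _. 0"])
      ((intro linears)+, simp)
  then show ?thesis by (simp add: growth_eq_grafting lookup_add)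
qed

section \<open>The projection onto primitive elements\<close>

text \<open>
  The solution \<open>\<pi>\<close> of \<open>F = \<epsilon>(F) 1 + \<Sum> F\<^sub>1 \<top> \<pi>(F\<^sub>2)\<close>, solved for the term with empty upper part. The
  condition on the weight excludes exactly this term.
\<close>

function proj_forest :: "forest \<Rightarrow> HCK" where
  "proj_forest F = (if F = {#} then 0 else basis F -
     (\<Sum>p | p \<in> Poly_Mapping.keys (coproduct_forest F) \<and> weight (snd p) < weight F.
        Poly_Mapping.lookup (coproduct_forest F) p *\<^sub>R (basis (fst p) \<top> proj_forest (snd p))))"
  by pat_completeness auto
termination by (relation "Wellfounded.measure weight") auto

declare proj_forest.simps [simp del]

lemma proj_forest_empty [simp]: "proj_forest {#} = 0"
  by (subst proj_forest.simps) simp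

text \<open>
  The map \<open>x \<otimes> y \<mapsto> x \<top> \<pi>(y)\<close>. Once \<open>\<pi>\<close> is known to be the projection onto words of length one, it
  undoes the cut of a word in front of its last letter and kills all other cuts.
\<close>

definition reassemble :: "HCK2 \<Rightarrow> HCK" where
  "reassemble = linear_extension (\<lambda>(A, B). basis A \<top> proj_forest B)"

lemma linear_reassemble [linears]: "linear f \<Longrightarrow> linear (\<lambda>x. reassemble (f x))"
  unfolding reassemble_def by (intro linears)

lemma growth_0 [simp]: "x \<top> 0 = 0" "0 \<top> x = 0"
  by (rule linear_0[of "\<lambda>y. x \<top> y"] linear_0[of "\<lambda>y. y \<top> x"], intro linears)+

lemma reassemble_coproduct_forest:
  "reassemble (coproduct_forest F) = (if F = {#} then 0 else basis F)"
proof (cases "F = {#}")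
  case True
  then show ?thesis by (simp add: coproduct_forest_simps reassemble_def flip: basis_empty_pair)
next
  case False
  let ?low = "\<lambda>(A, B). if A = {#} then 0 else basis A \<top> proj_forest B"
  let ?K = "Poly_Mapping.keys (coproduct_forest F)"
  have split: "(\<lambda>(A, B). basis A \<top> proj_forest B) =
      (\<lambda>p. (case p of (A, B) \<Rightarrow> if A = {#} then proj_forest B else 0) + ?low p)"
    by (auto simp: growth_one_left)
  have "linear_extension ?low (coproduct_forest F) =
      (\<Sum>p\<in>?K. if weight (snd p) < weight F
        then Poly_Mapping.lookup (coproduct_forest F) p *\<^sub>R (basis (fst p) \<top> proj_forest (snd p)) else 0)"
    unfolding linear_extension_def
  proof (rule sum.cong[OF refl])
    fix p assume p: "p \<in> ?K"
    obtain A B where [simp]: "p = (A, B)" by fastforce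
    have "weight A + weight B = weight F" using coproduct_graded p by simp
    then have "A = {#} \<longleftrightarrow> \<not> weight B < weight F"
      using weight_eq_0_iff[of A] by linarith
    then show "Poly_Mapping.lookup (coproduct_forest F) p *\<^sub>R ?low p =
        (if weight (snd p) < weight F
         then Poly_Mapping.lookup (coproduct_forest F) p *\<^sub>R (basis (fst p) \<top> proj_forest (snd p)) else 0)"
      by simp
  qed
  also have "\<dots> = basis F - proj_forest F"
    using False by (subst proj_forest.simps) (simp add: sum.If_cases Int_def)
  finally show ?thesis
    using False by (simp add: reassemble_def split linear_extension_fun_add counit_left_apply)
qed

text \<open>
  Let \<open>d(B)\<close> be the failure of \<open>\<pi>(B)\<close> to be primitive. By the counit axiom and the induction hypothesis,
  \<open>d(F)\<close> is the sum over all cuts \<open>(A, B)\<close> of \<open>F\<close> of the failure of \<open>coproduct_growth\<close> for \<open>A \<top> \<pi>(B)\<close>.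
  For non-empty \<open>F\<close>, coassociativity and the equation \<open>G = \<epsilon>(G) 1 + \<Sum> G\<^sub>1 \<top> \<pi>(G\<^sub>2)\<close>, for \<open>F\<close> and its lower
  parts \<open>G\<close>, show that this sum vanishes.
\<close>

lemma proj_forest_primitive: "proj_forest F \<in> primitives"
proof (induction "weight F" arbitrary: F rule: less_induct)
  case less
  define d where "d B = coproduct (proj_forest B) - (tensor (proj_forest B) 1 + tensor 1 (proj_forest B))" for B
  let ?t = "\<lambda>(A, B). linear_extension (\<lambda>(C, D). tensor (basis C) (basis D \<top> proj_forest B)) (coproduct_forest A)"
  let ?r = "\<lambda>(A, B). basis A \<top> proj_forest B"
  have "d F = linear_extension (\<lambda>(A, B). if A = {#} then d B else 0) (coproduct_forest F)"
    by (simp add: counit_left_apply)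
  also have "\<dots> = linear_extension (\<lambda>p. coproduct (?r p) - (tensor (?r p) 1 + ?t p)) (coproduct_forest F)"
  proof (rule linear_extension_cong)
    fix p assume "p \<in> Poly_Mapping.keys (coproduct_forest F)"
    then obtain A B where p: "p = (A, B)" and AB: "(A, B) \<in> Poly_Mapping.keys (coproduct_forest F)"
      by (cases p) auto
    show "(case p of (A, B) \<Rightarrow> if A = {#} then d B else 0) = coproduct (?r p) - (tensor (?r p) 1 + ?t p)"
    proof (cases "A = {#}")
      case True
      then show ?thesis
        by (simp add: p d_def growth_one_left coproduct_forest_simps flip: basis_empty_pair)
    next
      case False
      then have "weight B < weight F" using coproduct_graded[OF AB] weight_eq_0_iff[of A] by linarith
      then have "proj_forest B \<in> primitives" by (rule less)
      then show ?thesis using False by (simp add: p coproduct_growth coproduct_basis)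
    qed
  qed
  also have "\<dots> = coproduct (reassemble (coproduct_forest F)) -
      (tensor (reassemble (coproduct_forest F)) 1 + linear_extension ?t (coproduct_forest F))"
    using linear_image_linear_extension[OF linear_coproduct[OF linear_id'], of ?r]
      linear_image_linear_extension[where f = "\<lambda>x. tensor x (1::HCK)" and \<phi> = ?r, OF linear_tensor(1)[OF linear_id']]
    by (simp add: linear_extension_fun_add linear_extension_fun_diff reassemble_def)
  also have "linear_extension ?t (coproduct_forest F) =
      linear_extension (\<lambda>(A, B). tensor (basis A) (reassemble (coproduct_forest B))) (coproduct_forest F)"
  proof -
    have "tensor x (reassemble z) = linear_extension (\<lambda>(C, D). tensor x (basis C \<top> proj_forest D)) z"
      for x :: HCK and z
      unfolding reassemble_def
      by (subst linear_image_linear_extension[where f = "tensor x"]) (auto intro!: linears simp: case_prod_unfold)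
    then show ?thesis
      by (simp add: coassociative_apply[of "\<lambda>A B C. tensor (basis A) (basis B \<top> proj_forest C)"])
  qed
  also have "\<dots> = coproduct_forest F - tensor (basis F) 1"
  proof -
    have "(\<lambda>(A, B). tensor (basis A) (reassemble (coproduct_forest B))) =
        (\<lambda>p. basis p - (case p of (A, B) \<Rightarrow> if B = {#} then basis (A, {#}) else (0 :: HCK2)))"
      by (auto simp: reassemble_coproduct_forest tensor_basis)
    then show ?thesis
      by (simp add: linear_extension_fun_diff linear_extension_expand counit_right_apply)
  qed
  finally have "F \<noteq> {#} \<Longrightarrow> d F = 0"
    by (simp add: reassemble_coproduct_forest coproduct_basis)
  moreover have "coproduct 0 = 0" by (simp add: coproduct_def)
  ultimately show "proj_forest F \<in> primitives"
    by (cases "F = {#}") (auto simp: primitives_def d_def)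
qed

definition proj :: "HCK \<Rightarrow> HCK" where
  "proj = linear_extension proj_forest"

lemma proj_basis [simp]: "proj (basis F) = proj_forest F"
  by (simp add: proj_def)

lemma reassemble_coproduct: "reassemble (coproduct x) = x - Poly_Mapping.lookup x {#} *\<^sub>R 1"
  by (rule linear_eq_on_basis[where f = "\<lambda>x. reassemble (coproduct x)"])
    ((intro linears)+, auto simp: coproduct_basis reassemble_coproduct_forest lookup_basis)

subsection \<open>Words in primitive elements\<close>

lemma growth_word_snoc: "growth_word (ps @ [p]) = growth_word ps \<top> p"
  by (simp add: growth_word_def)

lemma growth_word_Nil [simp]: "growth_word [] = 1"
  by (simp add: growth_word_def)

text \<open>
  For non-empty \<open>F\<close>, in \<open>F = \<Sum> F\<^sub>1 \<top> \<pi>(F\<^sub>2)\<close> the factor \<open>\<pi>(F\<^sub>2)\<close> is primitive and vanishes for empty \<open>F\<^sub>2\<close>, so that only \<open>F\<^sub>1\<close>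
  of smaller weight occur.
\<close>

lemma forest_in_span_words:
  "basis F \<in> span (growth_word ` {ps. set ps \<subseteq> primitives})"
proof (induction "weight F" arbitrary: F rule: less_induct)
  case less
  let ?W = "span (growth_word ` {ps. set ps \<subseteq> primitives})"
  have snoc: "x \<top> p \<in> ?W" if "x \<in> ?W" "p \<in> primitives" for x p
  proof (rule span_induct[OF that(1), of "\<lambda>x. x \<top> p \<in> ?W"])
    fix x assume "x \<in> growth_word ` {ps. set ps \<subseteq> primitives}"
    then obtain ps where ps: "x = growth_word ps" "set ps \<subseteq> primitives" by auto
    have "growth_word (ps @ [p]) \<in> ?W" by (rule span_base) (use ps that in auto)
    then show "x \<top> p \<in> ?W" by (simp add: ps growth_word_snoc)
  next
    have "linear (\<lambda>x. x \<top> p)" by (intro linears)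
    then show "subspace {x. x \<top> p \<in> ?W}"
      by (auto simp: subspace_def linear_add[where f = "\<lambda>x. x \<top> p"] linear_scale[where f = "\<lambda>x. x \<top> p"]
          span_add span_scale span_zero)
  qed
  have "growth_word [] \<in> ?W" by (rule span_base, rule imageI) simp
  then have one: "1 \<in> ?W" by simp
  show ?case
  proof (cases "F = {#}")
    case False
    have "basis F = reassemble (coproduct_forest F)"
      using False by (simp add: reassemble_coproduct_forest)
    also have "\<dots> \<in> ?W"
      unfolding reassemble_def linear_extension_def
    proof (rule span_sum, rule span_scale, clarify)
      fix A B assume AB: "(A, B) \<in> Poly_Mapping.keys (coproduct_forest F)"
      show "basis A \<top> proj_forest B \<in> ?W"
      proof (cases "B = {#}")
        case True
        then show ?thesis by (simp add: span_zero)
      next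
        case False
        then have "weight A < weight F"
          using coproduct_graded[OF AB] weight_eq_0_iff[of B] by linarith
        then show ?thesis by (intro snoc less proj_forest_primitive)
      qed
    qed
    finally show ?thesis .
  qed (use one in simp)
qed

lemma span_growth_words: "span (growth_word ` {ps. set ps \<subseteq> primitives}) = UNIV"
proof -
  have "linear_extension basis x \<in> span (growth_word ` {ps. set ps \<subseteq> primitives})" for x
    unfolding linear_extension_def by (intro span_sum span_scale forest_in_span_words)
  then show ?thesis by (auto simp: linear_extension_expand)
qed

lemma coproduct_growth_word:
  "set ps \<subseteq> primitives \<Longrightarrow> coproduct (growth_word ps) =
     (\<Sum>i\<le>length ps. tensor (growth_word (take i ps)) (growth_word (drop i ps)))"
proof (induction ps rule: rev_induct)
  case Nil
  then show ?case by (simp add: coproduct_basis coproduct_forest_simps tensor_basis flip: basis_empty)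
next
  case (snoc p ps)
  let ?T = "linear_extension (\<lambda>(A, B). tensor (basis A) (basis B \<top> p))"
  have "?T (tensor x y) = tensor x (y \<top> p)" for x y :: HCK
    by (rule linear_extension_tensor) (auto intro!: linears)
  then have "?T (\<Sum>i\<le>length ps. tensor (growth_word (take i ps)) (growth_word (drop i ps))) =
      (\<Sum>i\<le>length ps. tensor (growth_word (take i (ps @ [p]))) (growth_word (drop i (ps @ [p]))))"
    by (simp add: linear_extension_sum growth_word_snoc)
  then show ?case
    using snoc by (simp add: growth_word_snoc coproduct_growth)
qed

lemma counit_growth_word:
  "set ps \<subseteq> primitives \<Longrightarrow> ps \<noteq> [] \<Longrightarrow> Poly_Mapping.lookup (growth_word ps) {#} = 0"
  by (cases ps rule: rev_cases) (auto simp: growth_word_snoc counit_growth primitive_counit)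

text \<open>
  A word is the sum of \<open>x \<top> \<pi>(y)\<close> over its deconcatenations \<open>(x, y)\<close>. If it has at
  least two letters, then by induction a proper suffix \<open>y\<close> contributes only if it has length one, and
  this contribution is already the whole word. Hence \<open>\<pi>\<close> of the word, the term for \<open>y\<close> the whole word, is \<open>0\<close>.
\<close>

lemma proj_growth_word:
  "set ps \<subseteq> primitives \<Longrightarrow> proj (growth_word ps) = (if length ps = 1 then hd ps else 0)"
proof (induction "length ps" arbitrary: ps rule: less_induct)
  case less
  show ?case
  proof (cases ps rule: rev_cases)
    case Nil
    then show ?thesis by (simp add: proj_def flip: basis_empty)
  next
    case (snoc qs p)
    let ?n = "length qs"
    have R: "reassemble (tensor x y) = x \<top> proj y" for x y
      unfolding reassemble_def by (rule linear_extension_tensor) (auto intro!: linears simp: proj_def)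
    have tail: "proj (growth_word (drop (Suc i) ps)) = (if Suc i = ?n then p else 0)" if "i \<le> ?n" for i
    proof -
      have "set (drop (Suc i) ps) \<subseteq> primitives" using less.prems set_drop_subset by fastforce
      then have "proj (growth_word (drop (Suc i) ps)) =
          (if length (drop (Suc i) ps) = 1 then hd (drop (Suc i) ps) else 0)"
        by (intro less.hyps) (simp_all add: snoc)
      then show ?thesis using that by (auto simp: snoc hd_drop_conv_nth)
    qed
    have len: "length ps = Suc ?n" by (simp add: snoc)
    have "growth_word ps = reassemble (coproduct (growth_word ps))"
      using counit_growth_word[OF less.prems] by (simp add: reassemble_coproduct snoc)
    also have "\<dots> = (\<Sum>i\<le>length ps. growth_word (take i ps) \<top> proj (growth_word (drop i ps)))"
      unfolding coproduct_growth_word[OF less.prems] linear_sum[OF linear_reassemble[OF linear_id']] R ..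
    also have "\<dots> = proj (growth_word ps) +
        (\<Sum>i\<le>?n. growth_word (take (Suc i) ps) \<top> proj (growth_word (drop (Suc i) ps)))"
      unfolding len by (subst sum.atMost_Suc_shift) (simp add: growth_one_left)
    also have "(\<Sum>i\<le>?n. growth_word (take (Suc i) ps) \<top> proj (growth_word (drop (Suc i) ps))) =
        (\<Sum>i\<le>?n. if Suc i = ?n then growth_word ps else 0)"
    proof (rule sum.cong[OF refl])
      fix i assume "i \<in> {..?n}"
      then have i: "i \<le> ?n" by simp
      show "growth_word (take (Suc i) ps) \<top> proj (growth_word (drop (Suc i) ps)) =
          (if Suc i = ?n then growth_word ps else 0)"
        unfolding tail[OF i] by (simp add: snoc growth_word_snoc)
    qed
    also have "\<dots> = (if ?n = 0 then 0 else growth_word ps)"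
      by (cases ?n) (simp_all add: sum.delta)
    finally show ?thesis by (auto simp: snoc growth_word_def growth_one_left split: if_splits)
  qed
qed

text \<open>
  Uniqueness holds because words span the whole space, existence because \<open>proj\<close> has the
  required values.
\<close>

lemma primitive_projection_eq: "primitive_projection = proj"
  unfolding primitive_projection_def
proof (rule the_equality)
  show "linear proj \<and> (\<forall>ps. set ps \<subseteq> primitives \<longrightarrow>
      proj (growth_word ps) = (if length ps = 1 then hd ps else 0))"
    using proj_growth_word by (simp add: proj_def linear_linear_extension)
next
  fix q :: "HCK \<Rightarrow> HCK"
  assume q: "linear q \<and> (\<forall>ps. set ps \<subseteq> primitives \<longrightarrow>
      q (growth_word ps) = (if length ps = 1 then hd ps else 0))"
  show "q = proj"
  proof
    fix x
    show "q x = proj x"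
    proof (rule linear_eq_on[where f = q and g = proj])
      show "x \<in> span (growth_word ` {ps. set ps \<subseteq> primitives})"
        by (simp add: span_growth_words)
      show "q y = proj y" if "y \<in> growth_word ` {ps. set ps \<subseteq> primitives}" for y
        using that q proj_growth_word by auto
    qed (use q in \<open>auto simp: proj_def linear_linear_extension\<close>)
  qed
qed

section \<open>The quasi-shuffle algebra\<close>

lemma linear_append_letter [linears]: "linear f \<Longrightarrow> linear (\<lambda>x. append_letter (f x) a)"
  unfolding append_letter_def by (intro linears)

lemma linear_quasi_shuffle_times [linears]:
  "linear f \<Longrightarrow> linear (\<lambda>x. quasi_shuffle_times (f x) y)"
  "linear f \<Longrightarrow> linear (\<lambda>x. quasi_shuffle_times y (f x))"
  unfolding quasi_shuffle_times_def by (intro linears; assumption)+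

lemma append_letter_basis [simp]: "append_letter (basis w) a = basis (w @ [a])"
  by (simp add: append_letter_def)

lemma quasi_shuffle_times_basis: "quasi_shuffle_times (basis w) (basis v) = quasi_shuffle w v"
  by (simp add: quasi_shuffle_times_def)

lemma quasi_shuffle_times_unit [simp]:
  "quasi_shuffle_times (basis []) x = x" "quasi_shuffle_times x (basis []) = x"
proof -
  show "quasi_shuffle_times (basis []) x = x"
    by (rule linear_eq_on_basis[where f = "quasi_shuffle_times (basis [])"])
      ((intro linears)+, simp add: quasi_shuffle_times_basis)
  show "quasi_shuffle_times x (basis []) = x"
    by (rule linear_eq_on_basis[where f = "\<lambda>x. quasi_shuffle_times x (basis [])"])
      ((intro linears)+, simp add: quasi_shuffle_times_basis)
qed

lemma quasi_shuffle_times_snoc: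
  "quasi_shuffle_times (append_letter x a) (append_letter y b) =
     append_letter (quasi_shuffle_times x (append_letter y b)) a
   + append_letter (quasi_shuffle_times (append_letter x a) y) b
   + append_letter (quasi_shuffle_times x y) (letter_times a b)"
  by (rule bilinear_eq_on_basis[where f = "\<lambda>x y. quasi_shuffle_times (append_letter x a) (append_letter y b)"])
    ((intro linears)+, simp add: quasi_shuffle_times_basis quasi_shuffle_snoc)

lemma append_letter_add: "append_letter (x + y) a = append_letter x a + append_letter y a"
  by (rule linear_add) (intro linears)

lemma quasi_shuffle_times_add:
  "quasi_shuffle_times (x + x') y = quasi_shuffle_times x y + quasi_shuffle_times x' y"
  "quasi_shuffle_times y (x + x') = quasi_shuffle_times y x + quasi_shuffle_times y x'"
  by (rule linear_add[of "\<lambda>x. quasi_shuffle_times x y"] linear_add[of "quasi_shuffle_times y"],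
      intro linears)+

lemma letter_times_commute: "letter_times a b = letter_times b a"
  and letter_times_assoc: "letter_times (letter_times a b) c = letter_times a (letter_times b c)"
  by (simp_all add: letter_times_def)

lemma quasi_shuffle_commute: "quasi_shuffle w v = quasi_shuffle v w"
proof (induction "length w + length v" arbitrary: w v rule: less_induct)
  case less
  show ?case
  proof (cases w rule: rev_cases)
    case w: (snoc w' a)
    show ?thesis
    proof (cases v rule: rev_cases)
      case v: (snoc v' b)
      have "quasi_shuffle w' v = quasi_shuffle v w'" "quasi_shuffle w v' = quasi_shuffle v' w"
        "quasi_shuffle w' v' = quasi_shuffle v' w'"
        by (rule less; simp add: w v)+
      then show ?thesis by (simp add: w v quasi_shuffle_snoc letter_times_commute[of a] add_ac)
    qed simp
  qed simp
qed

lemma quasi_shuffle_times_commute: "quasi_shuffle_times x y = quasi_shuffle_times y x"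
  by (rule bilinear_eq_on_basis[where f = quasi_shuffle_times])
    ((intro linears)+, simp add: quasi_shuffle_times_basis quasi_shuffle_commute)

text \<open>
  Both products of three non-empty words expand into seven terms, according to which of the three
  last letters form the last letter of the result.
\<close>

lemma quasi_shuffle_assoc:
  "quasi_shuffle_times (quasi_shuffle u v) (basis w) = quasi_shuffle_times (basis u) (quasi_shuffle v w)"
proof (induction "length u + length v + length w" arbitrary: u v w rule: less_induct)
  case less
  let ?m = quasi_shuffle_times
  have IH: "?m (?m (basis x) (basis y)) (basis z) = ?m (basis x) (?m (basis y) (basis z))"
    if "length x + length y + length z < length u + length v + length w" for x y z
    using less[OF that] by (simp add: quasi_shuffle_times_basis)
  show ?case
  proof (cases u rule: rev_cases)
    case u: (snoc u' a)
    show ?thesis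
    proof (cases v rule: rev_cases)
      case v: (snoc v' b)
      show ?thesis
      proof (cases w rule: rev_cases)
        case w: (snoc w' c)
        let ?u = "basis u'" and ?v = "basis v'" and ?w = "basis w'"
        let ?ua = "append_letter ?u a" and ?vb = "append_letter ?v b" and ?wc = "append_letter ?w c"
        have IHs: "?m (?m ?u ?vb) ?wc = ?m ?u (?m ?vb ?wc)" "?m (?m ?ua ?v) ?wc = ?m ?ua (?m ?v ?wc)"
          "?m (?m ?ua ?vb) ?w = ?m ?ua (?m ?vb ?w)" "?m (?m ?u ?v) ?wc = ?m ?u (?m ?v ?wc)"
          "?m (?m ?u ?vb) ?w = ?m ?u (?m ?vb ?w)" "?m (?m ?ua ?v) ?w = ?m ?ua (?m ?v ?w)"
          "?m (?m ?u ?v) ?w = ?m ?u (?m ?v ?w)"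
          unfolding append_letter_basis by (rule IH; simp add: u v w)+
        have left: "?m (?m ?ua ?vb) ?wc =
            append_letter (?m (?m ?u ?vb) ?wc) a + append_letter (?m (?m ?ua ?v) ?wc) b
          + append_letter (?m (?m ?u ?v) ?wc) (letter_times a b)
          + append_letter (?m (?m ?ua ?vb) ?w) c
          + append_letter (?m (?m ?u ?vb) ?w) (letter_times a c)
          + append_letter (?m (?m ?ua ?v) ?w) (letter_times b c)
          + append_letter (?m (?m ?u ?v) ?w) (letter_times (letter_times a b) c)"
          unfolding quasi_shuffle_times_snoc[of ?u a ?v b] quasi_shuffle_times_add
            quasi_shuffle_times_snoc[of _ _ ?w c] append_letter_add
          by (simp only: add_ac)
        have right: "?m ?ua (?m ?vb ?wc) =
            append_letter (?m ?u (?m ?vb ?wc)) a + append_letter (?m ?ua (?m ?v ?wc)) b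
          + append_letter (?m ?u (?m ?v ?wc)) (letter_times a b)
          + append_letter (?m ?ua (?m ?vb ?w)) c
          + append_letter (?m ?u (?m ?vb ?w)) (letter_times a c)
          + append_letter (?m ?ua (?m ?v ?w)) (letter_times b c)
          + append_letter (?m ?u (?m ?v ?w)) (letter_times a (letter_times b c))"
          unfolding quasi_shuffle_times_snoc[of ?v b ?w c] quasi_shuffle_times_add
            quasi_shuffle_times_snoc[of ?u a] append_letter_add
          by (simp only: add_ac)
        have "?m (?m ?ua ?vb) ?wc = ?m ?ua (?m ?vb ?wc)"
          unfolding left right IHs letter_times_assoc ..
        then show ?thesis by (simp add: u v w quasi_shuffle_times_basis)
      qed (simp add: quasi_shuffle_times_basis)
    qed (simp add: quasi_shuffle_times_basis)
  qed (simp add: quasi_shuffle_times_basis)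
qed

lemma quasi_shuffle_times_assoc:
  "quasi_shuffle_times (quasi_shuffle_times x y) z = quasi_shuffle_times x (quasi_shuffle_times y z)"
proof (rule bilinear_eq_on_basis[where f = "\<lambda>x y. quasi_shuffle_times (quasi_shuffle_times x y) z"])
  show "quasi_shuffle_times (quasi_shuffle_times (basis u) (basis v)) z =
      quasi_shuffle_times (basis u) (quasi_shuffle_times (basis v) z)" for u v
    by (rule linear_eq_on_basis[where x = z])
      ((intro linears)+, simp add: quasi_shuffle_times_basis quasi_shuffle_assoc)
qed (intro linears)+

text \<open>
  This makes the fold over a multiset in \<open>atilde_forest\<close> a product.
\<close>

lemma comp_fun_commute_quasi_shuffle_times: "comp_fun_commute quasi_shuffle_times"
proof
  fix x y
  show "quasi_shuffle_times y \<circ> quasi_shuffle_times x = quasi_shuffle_times x \<circ> quasi_shuffle_times y"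
    by (rule ext, simp add: quasi_shuffle_times_assoc[symmetric]) (metis quasi_shuffle_times_commute)
qed

lemma atilde_forest_simps:
  "atilde_forest {#} = basis []"
  "atilde_forest {#Node F#} = append_letter (atilde_forest F) 0"
  "atilde_forest (F + G) = quasi_shuffle_times (atilde_forest F) (atilde_forest G)"
proof -
  interpret comp_fun_commute quasi_shuffle_times
    by (rule comp_fun_commute_quasi_shuffle_times)
  show "atilde_forest (F + G) = quasi_shuffle_times (atilde_forest F) (atilde_forest G)"
    by (induction F) (simp_all add: atilde_forest_def quasi_shuffle_times_assoc)
  show "atilde_forest {#Node F#} = append_letter (atilde_forest F) 0"
    by (simp add: atilde_forest_def)
qed (simp add: atilde_forest_def)

lemma linear_atilde [linears]: "linear f \<Longrightarrow> linear (\<lambda>x. atilde (f x))"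
  unfolding atilde_def by (intro linears)

lemma atilde_basis [simp]: "atilde (basis F) = atilde_forest F"
  by (simp add: atilde_def)

lemma atilde_mult: "atilde (x * y) = quasi_shuffle_times (atilde x) (atilde y)"
  unfolding atilde_def
  by (rule linear_extension_mult2) (auto intro!: linears simp: atilde_forest_simps)

section \<open>The image of the natural growth in the quasi-shuffle algebra\<close>

definition concatenate :: "QSh \<Rightarrow> QSh \<Rightarrow> QSh" where
  "concatenate = bilinear_extension (\<lambda>w v. basis (w @ v))"

lemma linear_concatenate [linears]:
  "linear f \<Longrightarrow> linear (\<lambda>x. concatenate (f x) y)"
  "linear f \<Longrightarrow> linear (\<lambda>x. concatenate y (f x))"
  unfolding concatenate_def by (intro linears; assumption)+

lemma concatenate_basis: "concatenate (basis w) (basis v) = basis (w @ v)"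
  by (simp add: concatenate_def)

lemma concatenate_letter: "concatenate x (basis [a]) = append_letter x a"
  by (rule linear_eq_on_basis[where f = "\<lambda>x. concatenate x (basis [a])"])
    ((intro linears)+, simp add: concatenate_basis)

lemma concatenate_Nil [simp]: "concatenate (basis []) x = x"
  by (rule linear_eq_on_basis[where f = "concatenate (basis [])"])
    ((intro linears)+, simp add: concatenate_basis)

lemma concatenate_0 [simp]: "concatenate x 0 = 0" "concatenate 0 x = 0"
  by (rule linear_0[of "concatenate x"] linear_0[of "\<lambda>y. concatenate y x"], intro linears)+

definition edgeless :: "forest \<Rightarrow> bool" where
  "edgeless F \<longleftrightarrow> (\<forall>t\<in>#F. t = Node {#})"

text \<open>
  The part of \<open>atilde_forest F\<close> in words of length one. Since the letter \<open>j\<close> stands for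
  \<open>x\<^bsup>j+1\<^esup>\<close>, the forest of \<open>m\<close> isolated vertices is sent to the letter \<open>m - 1\<close>.
\<close>

definition letter_forest :: "forest \<Rightarrow> QSh" where
  "letter_forest F = (if F \<noteq> {#} \<and> edgeless F then basis [size F - 1] else 0)"

lemma letter_forest_empty [simp]: "letter_forest {#} = 0"
  by (simp add: letter_forest_def)

lemma letter_forest_node: "letter_forest {#Node F#} = (if F = {#} then basis [0] else 0)"
  by (simp add: letter_forest_def edgeless_def)

lemma edgeless_union: "edgeless (F + G) \<longleftrightarrow> edgeless F \<and> edgeless G"
  by (auto simp: edgeless_def)

definition letter_part :: "HCK \<Rightarrow> QSh" where
  "letter_part = linear_extension letter_forest"

lemma linear_letter_part [linears]: "linear f \<Longrightarrow> linear (\<lambda>x. letter_part (f x))"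
  unfolding letter_part_def by (intro linears)

lemma letter_part_basis [simp]: "letter_part (basis F) = letter_forest F"
  by (simp add: letter_part_def)

lemma letter_part_1 [simp]: "letter_part 1 = 0"
  using letter_part_basis[of "{#}"] by simp

text \<open>
  For the coproduct of \<open>F\<close>, \<open>last_letter\<close> recovers \<open>atilde_forest F\<close> by splitting off the last letter of
  every word, if \<open>F\<close> is not empty. The companion \<open>no_letter\<close> splits off the empty word and recovers
  \<open>atilde_forest F\<close> by the counit axiom.
\<close>

definition last_letter :: "HCK2 \<Rightarrow> QSh" where
  "last_letter = linear_extension (\<lambda>(A, B). concatenate (atilde_forest A) (letter_forest B))"

definition no_letter :: "HCK2 \<Rightarrow> QSh" where
  "no_letter = linear_extension (\<lambda>(A, B). if B = {#} then atilde_forest A else 0)"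

lemma linear_last_letter [linears]: "linear f \<Longrightarrow> linear (\<lambda>x. last_letter (f x))"
  unfolding last_letter_def by (intro linears)

lemma linear_no_letter [linears]: "linear f \<Longrightarrow> linear (\<lambda>x. no_letter (f x))"
  unfolding no_letter_def by (intro linears)

lemma no_letter_coproduct: "no_letter (coproduct x) = atilde x"
  unfolding no_letter_def atilde_def by (rule counit_right_linear)

definition last_left :: "HCK2 \<Rightarrow> QSh \<Rightarrow> QSh" where
  "last_left z x = linear_extension (\<lambda>(A, B).
     concatenate (quasi_shuffle_times (atilde_forest A) x) (letter_forest B)) z"

lemma linear_last_left [linears]:
  "linear f \<Longrightarrow> linear (\<lambda>x. last_left (f x) y)"
  "linear g \<Longrightarrow> linear (\<lambda>x. last_left z (g x))"
  unfolding last_left_def by (intro linears; assumption)+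

lemma last_left_0 [simp]: "last_left z 0 = 0"
  by (rule linear_0) (intro linears)

text \<open>
  The recursion for the quasi-shuffle product, for two words with separated last letters. On the
  coproducts of two non-empty forests \<open>no_letter\<close> and \<open>last_letter\<close> agree, so that both correction
  terms vanish; as an identity on the whole tensor square it can be checked on pairs of forests.
\<close>

lemma last_letter_mult:
  "last_letter (z * w) = quasi_shuffle_times (last_letter z) (last_letter w)
     + last_left z (no_letter w - last_letter w) + last_left w (no_letter z - last_letter z)"
proof (rule bilinear_eq_on_basis[where f = "\<lambda>z w. last_letter (z * w)"])
  fix p q :: "forest \<times> forest"
  obtain A B C D where pq: "p = (A, B)" "q = (C, D)" by (metis surj_pair)
  have zero: "quasi_shuffle_times 0 x = 0" "quasi_shuffle_times x 0 = 0" for x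
    by (rule linear_0[of "\<lambda>x. quasi_shuffle_times x _"] linear_0[of "quasi_shuffle_times x"], intro linears)+
  have minus: "quasi_shuffle_times x (- y) = - quasi_shuffle_times x y" for x y
    by (rule linear_neg) (intro linears)
  have minus_append: "append_letter (- y) a = - append_letter y a" for y a
    by (rule linear_neg[of "\<lambda>y. append_letter y a"]) (intro linears)
  have merge: "letter_times (size B - 1) (size D - 1) = size (B + D) - 1" if "B \<noteq> {#}" "D \<noteq> {#}"
    using that by (cases "size B"; cases "size D") (auto simp: letter_times_def)
  show "last_letter (basis p * basis q) =
      quasi_shuffle_times (last_letter (basis p)) (last_letter (basis q))
      + last_left (basis p) (no_letter (basis q) - last_letter (basis q))
      + last_left (basis q) (no_letter (basis p) - last_letter (basis p))"
  proof (cases "B = {#} \<or> D = {#}")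
    case True
    then show ?thesis
      by (auto simp: pq basis_mult last_letter_def no_letter_def last_left_def atilde_forest_simps zero
          quasi_shuffle_times_commute[of "atilde_forest C"])
  next
    case False
    show ?thesis
    proof (cases "edgeless B \<and> edgeless D")
      case True
      then have "letter_forest (B + D) = basis [letter_times (size B - 1) (size D - 1)]"
        using False by (subst merge) (auto simp: letter_forest_def edgeless_union)
      moreover have "letter_forest B = basis [size B - 1]" "letter_forest D = basis [size D - 1]"
        using False True by (simp_all add: letter_forest_def)
      ultimately show ?thesis
        using False by (simp add: pq basis_mult last_letter_def no_letter_def last_left_def
            atilde_forest_simps concatenate_letter quasi_shuffle_times_snoc minus minus_append
            quasi_shuffle_times_commute[of "atilde_forest C"])
    next
      case 2: False
      then have "letter_forest (B + D) = 0" "letter_forest B = 0 \<or> letter_forest D = 0"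
        by (auto simp: letter_forest_def edgeless_union)
      then show ?thesis
        using False by (auto simp: pq basis_mult last_letter_def no_letter_def last_left_def zero)
    qed
  qed
qed (intro linears)+

text \<open>
  For a tree \<open>[F]\<close> the letter \<open>\<lambda>\<close> of the lower part is non-zero only if the lower part is the root alone,
  that is, for the cut that separates the root from all of \<open>F\<close>, which yields the word of \<open>F\<close> followed by \<open>x\<close>.
\<close>

lemma atilde_forest_last_letter:
  "last_letter (coproduct_forest F) = (if F = {#} then 0 else atilde_forest F)"
proof (induction F rule: forest_induct)
  case empty
  then show ?case by (simp add: coproduct_forest_simps last_letter_def flip: basis_empty_pair)
next
  case (node F)
  have "last_letter (below_root z) = append_letter (no_letter z) 0" for z
  proof (rule linear_eq_on_basis[where x = z])
    show "last_letter (below_root (basis p)) = append_letter (no_letter (basis p)) 0" for p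
      by (cases p)
        (simp add: last_letter_def no_letter_def letter_forest_node concatenate_letter append_letter_def)
  qed (intro linears)+
  moreover have "no_letter (coproduct_forest F) = atilde_forest F"
    using no_letter_coproduct[of "basis F"] by (simp add: coproduct_basis)
  ultimately show ?case
    by (simp add: coproduct_forest_simps last_letter_def linear_extension_add atilde_forest_simps)
next
  case (union F G)
  have no: "no_letter (coproduct_forest H) = atilde_forest H" for H
    using no_letter_coproduct[of "basis H"] by (simp add: coproduct_basis)
  show ?case
  proof (cases "F = {#} \<or> G = {#}")
    case True
    then show ?thesis using union.IH by auto
  next
    case False
    then show ?thesis
      by (simp add: coproduct_forest_simps last_letter_mult no union.IH atilde_forest_simps)
  qed
qed

lemma atilde_eq_last_letter:
  "atilde x = Poly_Mapping.lookup x {#} *\<^sub>R basis [] + last_letter (coproduct x)"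
  by (rule linear_eq_on_basis[where f = atilde])
    ((intro linears)+, auto simp: coproduct_basis atilde_forest_last_letter lookup_basis atilde_forest_simps)

text \<open>
  A grafting of a non-empty forest has an edge and hence no part in words of length one.
\<close>

lemma letter_part_growth:
  "letter_part (x \<top> y) =
     Poly_Mapping.lookup x {#} *\<^sub>R letter_part y + Poly_Mapping.lookup y {#} *\<^sub>R letter_part x"
proof (rule bilinear_eq_on_basis[where f = "\<lambda>x y. letter_part (x \<top> y)"])
  fix F G
  show "letter_part (basis F \<top> basis G) = Poly_Mapping.lookup (basis F) {#} *\<^sub>R letter_part (basis G)
      + Poly_Mapping.lookup (basis G) {#} *\<^sub>R letter_part (basis F)"
  proof (cases "F = {#}")
    case True
    then show ?thesis using growth_one_left[of "basis G"] by (simp add: lookup_basis)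
  next
    case False
    have "letter_part (graft_all F G) = linear_extension (\<lambda>H. 0) (graft_all F G)"
      unfolding letter_part_def
      by (rule linear_extension_cong) (use keys_graft_all False in \<open>auto simp: letter_forest_def edgeless_def\<close>)
    then have "letter_part (c *\<^sub>R graft_all F G) = 0" for c
      by (simp add: letter_part_def linear_extension_scaleR)
    then show ?thesis
      using False by (simp add: growth_basis growth_forest_eq lookup_basis)
  qed
qed (intro linears)+

text \<open>
  By \<open>coproduct_growth\<close> and \<open>letter_part_growth\<close> the last letter of \<open>x \<top> p\<close> comes from \<open>p\<close>: the
  remaining cuts split \<open>x\<close>, and only those with lower part \<open>1 \<top> p\<close> survive.
\<close>

lemma atilde_growth:
  assumes "p \<in> primitives"
  shows "atilde (x \<top> p) = concatenate (atilde x) (letter_part p)"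
proof -
  have T: "last_letter (tensor x y) = concatenate (atilde x) (letter_part y)" for x y
    unfolding last_letter_def
    by (rule linear_extension_tensor) (auto intro!: linears)
  have "last_letter (linear_extension (\<lambda>(A, B). tensor (basis A) (basis B \<top> p)) z) =
      concatenate (no_letter z) (letter_part p)" for z
  proof (rule linear_eq_on_basis[where x = z])
    fix q :: "forest \<times> forest"
    show "last_letter (linear_extension (\<lambda>(A, B). tensor (basis A) (basis B \<top> p)) (basis q)) =
        concatenate (no_letter (basis q)) (letter_part p)"
      using primitive_counit[OF assms]
      by (cases q) (auto simp: T letter_part_growth lookup_basis no_letter_def)
  qed (intro linears)+
  then have "last_letter (coproduct (x \<top> p)) = concatenate (atilde x) (letter_part p)"
    by (simp add: coproduct_growth[OF assms] linear_add[OF linear_last_letter[OF linear_id']] T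
        no_letter_coproduct)
  then show ?thesis
    by (subst atilde_eq_last_letter) (simp add: counit_growth primitive_counit[OF assms])
qed

text \<open>
  For non-empty \<open>F\<close>, in \<open>F = \<Sum> F\<^sub>1 \<top> \<pi>(F\<^sub>2)\<close> only the term \<open>\<pi>(F)\<close> with empty \<open>F\<^sub>1\<close> has a part in words of length one.
\<close>

lemma letter_part_proj: "letter_part (proj_forest F) = letter_forest F"
proof (cases "F = {#}")
  case True
  then show ?thesis using linear_0[OF linear_letter_part[OF linear_id']] by simp
next
  case False
  have "letter_forest F = letter_part (reassemble (coproduct_forest F))"
    using False by (simp add: reassemble_coproduct_forest)
  also have "\<dots> = linear_extension (\<lambda>p. letter_part (case p of (A, B) \<Rightarrow> basis A \<top> proj_forest B)) (coproduct_forest F)"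
    unfolding reassemble_def by (rule linear_image_linear_extension) (intro linears)
  also have "(\<lambda>p. letter_part (case p of (A, B) \<Rightarrow> basis A \<top> proj_forest B)) =
      (\<lambda>(A, B). if A = {#} then letter_part (proj_forest B) else 0)"
    by (auto simp: letter_part_growth lookup_basis primitive_counit[OF proj_forest_primitive])
  finally show ?thesis by (simp add: counit_left_apply)
qed

lemma atilde_primitive: "p \<in> primitives \<Longrightarrow> atilde p = letter_part p"
  using atilde_growth[of p 1] atilde_basis[of "{#}"] by (simp add: growth_one_left atilde_forest_simps)

lemma atilde_growth_power:
  assumes "p \<in> primitives" "letter_part p = basis [c]"
  shows "atilde (growth_power p n) = basis (replicate n c)"
proof (induction n)
  case 0
  then show ?case using atilde_basis[of "{#}"] by (simp add: atilde_forest_simps)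
next
  case (Suc n)
  then show ?case
    by (simp add: atilde_growth assms concatenate_letter replicate_append_same)
qed

lemma letter_forest_isolated_vertices:
  "m \<ge> 1 \<Longrightarrow> letter_forest (isolated_vertices m) = basis [m - 1]"
  by (auto simp: letter_forest_def isolated_vertices_def edgeless_def)

subsection \<open>Multiplying a letter with a power of a letter\<close>

definition insert_letter :: "letter \<Rightarrow> letter \<Rightarrow> nat \<Rightarrow> QSh" where
  "insert_letter c d j = (\<Sum>i\<le>j. basis (replicate i c @ [d] @ replicate (j - i) c))"

lemma insert_letter_Suc:
  "insert_letter c d (Suc j) = append_letter (insert_letter c d j) c + basis (replicate (Suc j) c @ [d])"
proof -
  have "append_letter (insert_letter c d j) c =
      (\<Sum>i\<le>j. basis (replicate i c @ [d] @ replicate (Suc j - i) c))"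
    unfolding insert_letter_def append_letter_def linear_extension_sum
    by (rule sum.cong) (auto simp: Suc_diff_le replicate_append_same)
  then show ?thesis by (simp add: insert_letter_def)
qed

text \<open>
  The letter \<open>d\<close> is either inserted between the letters \<open>c\<close> or merged with one of them.
\<close>

lemma letter_times_power:
  "quasi_shuffle [d] (replicate j c) =
     insert_letter c d j + (if j = 0 then 0 else insert_letter c (letter_times d c) (j - 1))"
proof (induction j)
  case 0
  then show ?case by (simp add: insert_letter_def)
next
  case step: (Suc j)
  have "quasi_shuffle [d] (replicate (Suc j) c) = quasi_shuffle ([] @ [d]) (replicate j c @ [c])"
    by (simp add: replicate_append_same)
  also have "\<dots> = basis (replicate (Suc j) c @ [d]) + append_letter (quasi_shuffle [d] (replicate j c)) c
      + basis (replicate j c @ [letter_times d c])"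
    unfolding quasi_shuffle_snoc by (simp add: replicate_append_same)
  also have "\<dots> = insert_letter c d (Suc j) + insert_letter c (letter_times d c) j"
  proof (cases j)
    case 0
    then show ?thesis by (simp add: step.IH insert_letter_Suc) (simp add: insert_letter_def)
  next
    case (Suc i)
    then show ?thesis
      using insert_letter_Suc[of c "letter_times d c" i]
      unfolding step.IH by (simp add: append_letter_add insert_letter_Suc[of c d "Suc i"])
  qed
  finally show ?case by simp
qed

text \<open>
  Merging \<open>x\<^bsup>mk\<^esup>\<close> with \<open>x\<^sup>m\<close> gives \<open>x\<^bsup>m(k+1)\<^esup>\<close>, so the merged terms for \<open>k\<close> are the inserted terms for
  \<open>k + 1\<close>, and the alternating sum telescopes.
\<close>

lemma letter_power_recursion:
  assumes "m \<ge> 1" "n \<ge> 1"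
  shows "(\<Sum>k = 1..n. (- 1) ^ (k - 1) *\<^sub>R quasi_shuffle [m * k - 1] (replicate (n - k) (m - 1))) =
    real n *\<^sub>R basis (replicate n (m - 1))"
proof -
  let ?I = "\<lambda>k. insert_letter (m - 1) (m * Suc k - 1) (n - Suc k)"
  have merge: "letter_times (m * Suc k - 1) (m - 1) = m * Suc (Suc k) - 1" for k
    using assms(1) by (cases m) (auto simp: letter_times_def)
  have "(\<Sum>k = 1..n. (- 1) ^ (k - 1) *\<^sub>R quasi_shuffle [m * k - 1] (replicate (n - k) (m - 1))) =
      (\<Sum>k<n. (- 1) ^ k *\<^sub>R quasi_shuffle [m * Suc k - 1] (replicate (n - Suc k) (m - 1)))"
    by (rule sum.reindex_bij_witness[of _ Suc "\<lambda>k. k - 1"]) auto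
  also have "\<dots> = (\<Sum>k<n. (- 1) ^ k *\<^sub>R ?I k - (if Suc k = n then 0 else (- 1) ^ Suc k *\<^sub>R ?I (Suc k)))"
    by (rule sum.cong[OF refl]) (auto simp: letter_times_power merge[simplified] scaleR_add_right Suc_diff_Suc)
  \<comment> \<open>The case \<open>k = n\<close>, in which no letter is left to merge with, is written so that consecutive terms cancel.\<close>
  also have "\<dots> = (\<Sum>k<n. (if k = n then 0 else (- 1) ^ k *\<^sub>R ?I k) -
      (if Suc k = n then 0 else (- 1) ^ Suc k *\<^sub>R ?I (Suc k)))"
    by (rule sum.cong[OF refl]) auto
  also have "\<dots> = (if 0 = n then 0 else (- 1) ^ 0 *\<^sub>R ?I 0) - (if n = n then 0 else (- 1) ^ n *\<^sub>R ?I n)"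
    by (rule sum_lessThan_telescope')
  also have "\<dots> = insert_letter (m - 1) (m - 1) (n - 1)"
    using assms by simp
  also have "\<dots> = (\<Sum>i\<le>n - 1. basis (replicate n (m - 1)))"
    unfolding insert_letter_def
  proof (rule sum.cong[OF refl])
    fix i assume "i \<in> {..n - 1}"
    then have n: "n = i + Suc (n - 1 - i)" using assms by auto
    show "basis (replicate i (m - 1) @ [m - 1] @ replicate (n - 1 - i) (m - 1)) =
        basis (replicate n (m - 1))"
      by (subst (2) n) (simp add: replicate_add replicate_app_Cons_same)
  qed
  also have "\<dots> = real n *\<^sub>R basis (replicate n (m - 1))"
    using assms by (simp add: sum_constant_scaleR del: sum_constant)
  finally show ?thesis .
qed

section \<open>The logarithm of a power series\<close>

text \<open>
  The index set of \<open>P_polynomial\<close> for \<open>N = k\<close>, with \<open>a i\<close> parts equal to \<open>i\<close>. A separate bound \<open>N\<close> on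
  the parts makes it possible to remove a part without changing the range of the index.
\<close>

definition partitions :: "nat \<Rightarrow> nat \<Rightarrow> (nat \<Rightarrow> nat) set" where
  "partitions N k = {a. (\<forall>i. i \<notin> {1..N} \<longrightarrow> a i = 0) \<and> (\<Sum>i = 1..N. i * a i) = k}"

lemma finite_partitions [simp]: "finite (partitions N k)"
proof (rule finite_subset)
  show "partitions N k \<subseteq> {a. \<forall>i. (i \<in> {1..N} \<longrightarrow> a i \<in> {..k}) \<and> (i \<notin> {1..N} \<longrightarrow> a i = 0)}"
  proof clarify
    fix a i assume a: "a \<in> partitions N k"
    have "a i \<le> k" if i: "i \<in> {1..N}"
    proof -
      have "a i \<le> i * a i" using i by simp
      also have "\<dots> \<le> (\<Sum>i = 1..N. i * a i)" by (rule member_le_sum) (use i in auto)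
      finally show ?thesis using a by (simp add: partitions_def)
    qed
    then show "(i \<in> {1..N} \<longrightarrow> a i \<in> {..k}) \<and> (i \<notin> {1..N} \<longrightarrow> a i = 0)"
      using a by (auto simp: partitions_def)
  qed
  show "finite {a. \<forall>i. (i \<in> {1..N} \<longrightarrow> a i \<in> {..k}) \<and> (i \<notin> {1..N} \<longrightarrow> a i = (0::nat))}"
    by (rule finite_set_of_finite_funs) auto
qed

lemma partitions_large:
  assumes "k \<le> N"
  shows "partitions N k = partitions k k"
proof -
  have sum: "(\<Sum>i = 1..N. i * a i) = (\<Sum>i = 1..k. i * a i)" if "\<forall>i. i \<notin> {1..k} \<longrightarrow> a i = 0" for a :: "nat \<Rightarrow> nat"
    by (rule sum.mono_neutral_right) (use assms that in auto)
  have "\<forall>i. i \<notin> {1..k} \<longrightarrow> a i = 0" if a: "a \<in> partitions N k" for a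
  proof (intro allI impI, rule ccontr)
    fix i assume i: "i \<notin> {1..k}" "a i \<noteq> 0"
    then have N: "i \<in> {1..N}" "i > k" using a by (auto simp: partitions_def)
    have "i \<le> i * a i" using i(2) by simp
    also have "\<dots> \<le> (\<Sum>i = 1..N. i * a i)" by (rule member_le_sum) (use N in auto)
    finally show False using a N by (simp add: partitions_def)
  qed
  then have "a \<in> partitions k k" if "a \<in> partitions N k" for a
    using that sum[of a] by (simp add: partitions_def)
  moreover have "a \<in> partitions N k" if "a \<in> partitions k k" for a
    using that sum[of a] assms by (auto simp: partitions_def)
  ultimately show ?thesis by blast
qed

definition monomial :: "(nat \<Rightarrow> real) \<Rightarrow> nat \<Rightarrow> (nat \<Rightarrow> nat) \<Rightarrow> real" where
  "monomial h N a = (\<Prod>i = 1..N. h i ^ a i / fact (a i))"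

definition partition_sum :: "(nat \<Rightarrow> real) \<Rightarrow> (nat \<Rightarrow> real) \<Rightarrow> nat \<Rightarrow> nat \<Rightarrow> real" where
  "partition_sum h w N k = (\<Sum>a\<in>partitions N k. w (\<Sum>i = 1..N. a i) * monomial h N a)"

lemma partition_sum_large:
  assumes "k \<le> N"
  shows "partition_sum h w N k = partition_sum h w k k"
  unfolding partition_sum_def partitions_large[OF assms]
proof (rule sum.cong[OF refl])
  fix a assume "a \<in> partitions k k"
  then have a: "a i = 0" if "i \<notin> {1..k}" for i using that by (simp add: partitions_def)
  have "(\<Sum>i = 1..N. a i) = (\<Sum>i = 1..k. a i)"
    by (rule sum.mono_neutral_right) (use assms a in auto)
  moreover have "monomial h N a = monomial h k a"
    unfolding monomial_def by (rule prod.mono_neutral_right) (use assms a in auto)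
  ultimately show "w (\<Sum>i = 1..N. a i) * monomial h N a = w (\<Sum>i = 1..k. a i) * monomial h k a"
    by simp
qed

lemma monomial_Suc:
  assumes "i \<in> {1..N}"
  shows "real (Suc (b i)) * monomial h N (b(i := Suc (b i))) = h i * monomial h N b"
proof -
  have "(\<Prod>j\<in>{1..N} - {i}. h j ^ (b(i := Suc (b i))) j / fact ((b(i := Suc (b i))) j)) =
      (\<Prod>j\<in>{1..N} - {i}. h j ^ b j / fact (b j))"
    by (rule prod.cong) auto
  then show ?thesis
    unfolding monomial_def prod.remove[OF finite_atLeastAtMost assms]
    by (simp add: field_simps del: of_nat_Suc)
qed

text \<open>
  Remove one part \<open>i\<close> from every partition that has one: the factor \<open>a i\<close> is absorbed by the factorial
  in the denominator of the monomial.
\<close>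

lemma sum_partitions_part:
  assumes i: "i \<in> {1..N}"
  shows "(\<Sum>a\<in>partitions N k. real (a i) * w (\<Sum>i = 1..N. a i) * monomial h N a) =
    (if i \<le> k then h i * partition_sum h (\<lambda>j. w (Suc j)) N (k - i) else 0)"
proof -
  let ?f = "\<lambda>a. real (a i) * w (\<Sum>i = 1..N. a i) * monomial h N a"
  have sum_upd: "(\<Sum>j = 1..N. g j ((b(i := x)) j)) = g i x + (\<Sum>j\<in>{1..N} - {i}. g j (b j))"
    for b :: "nat \<Rightarrow> nat" and x and g :: "nat \<Rightarrow> nat \<Rightarrow> nat"
  proof -
    have "(\<Sum>j\<in>{1..N} - {i}. g j ((b(i := x)) j)) = (\<Sum>j\<in>{1..N} - {i}. g j (b j))"
      by (rule sum.cong) auto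
    then show ?thesis unfolding sum.remove[OF finite_atLeastAtMost i] by simp
  qed
  have sum_rem: "(\<Sum>j = 1..N. g j (b j)) = g i (b i) + (\<Sum>j\<in>{1..N} - {i}. g j (b j))"
    for b :: "nat \<Rightarrow> nat" and g :: "nat \<Rightarrow> nat \<Rightarrow> nat"
    by (rule sum.remove[OF finite_atLeastAtMost i])
  have part: "i \<le> k" if "a \<in> partitions N k" "a i \<noteq> 0" for a
  proof -
    have "i \<le> i * a i" using that(2) by simp
    also have "\<dots> \<le> (\<Sum>j = 1..N. j * a j)"
      unfolding sum_rem[of "\<lambda>j x. j * x" a] by (rule le_add1)
    finally show ?thesis using that(1) by (simp add: partitions_def)
  qed
  have "(\<Sum>a\<in>partitions N k. ?f a) = (\<Sum>a | a \<in> partitions N k \<and> a i \<noteq> 0. ?f a)"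
    by (rule sum.mono_neutral_right) auto
  also have "\<dots> = (if i \<le> k then h i * partition_sum h (\<lambda>j. w (Suc j)) N (k - i) else 0)"
  proof (cases "i \<le> k")
    case False
    have "{a. a \<in> partitions N k \<and> a i \<noteq> 0} = {}" using part False by blast
    then show ?thesis using False by (simp only: sum.empty if_False)
  next
    case True
    have "(\<Sum>a | a \<in> partitions N k \<and> a i \<noteq> 0. ?f a) = (\<Sum>b\<in>partitions N (k - i). ?f (b(i := Suc (b i))))"
    proof (rule sum.reindex_bij_witness[of _ "\<lambda>b. b(i := Suc (b i))" "\<lambda>a. a(i := a i - 1)"])
      fix a assume a: "a \<in> {a. a \<in> partitions N k \<and> a i \<noteq> 0}"
      show "(a(i := a i - 1))(i := Suc ((a(i := a i - 1)) i)) = a" using a by auto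
      have "i * (a i - 1) + i = i * a i" using a by (cases "a i") auto
      then have "(\<Sum>j = 1..N. j * (a(i := a i - 1)) j) + i = (\<Sum>j = 1..N. j * a j)"
        using sum_upd[of "\<lambda>j x. j * x" a] sum_rem[of "\<lambda>j x. j * x" a] by simp
      then show "a(i := a i - 1) \<in> partitions N (k - i)"
        using a i by (auto simp: partitions_def)
    next
      fix b assume b: "b \<in> partitions N (k - i)"
      have "(\<Sum>j = 1..N. j * (b(i := Suc (b i))) j) = (\<Sum>j = 1..N. j * b j) + i"
        using sum_upd[of "\<lambda>j x. j * x" b] sum_rem[of "\<lambda>j x. j * x" b] by simp
      then show "b(i := Suc (b i)) \<in> {a. a \<in> partitions N k \<and> a i \<noteq> 0}"
        using b i True by (auto simp: partitions_def)
    qed auto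
    also have "\<dots> = (\<Sum>b\<in>partitions N (k - i). h i * (w (Suc (\<Sum>i = 1..N. b i)) * monomial h N b))"
    proof (rule sum.cong[OF refl])
      fix b
      have "(\<Sum>j = 1..N. (b(i := Suc (b i))) j) = Suc (\<Sum>j = 1..N. b j)"
        using sum_upd[of "\<lambda>j x. x" b] sum_rem[of "\<lambda>j x. x" b] by simp
      then show "?f (b(i := Suc (b i))) = h i * (w (Suc (\<Sum>i = 1..N. b i)) * monomial h N b)"
        using monomial_Suc[OF i, of b h] by (simp del: of_nat_Suc)
    qed
    finally show ?thesis using True by (simp add: partition_sum_def sum_distrib_left)
  qed
  finally show ?thesis .
qed

lemma sum_partitions_parts:
  "(\<Sum>a\<in>partitions k k. real (\<Sum>i = 1..k. c i * a i) * w (\<Sum>i = 1..k. a i) * monomial h k a) =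
    (\<Sum>i = 1..k. real (c i) * h i * partition_sum h (\<lambda>j. w (Suc j)) (k - i) (k - i))"
proof -
  have "(\<Sum>a\<in>partitions k k. real (\<Sum>i = 1..k. c i * a i) * w (\<Sum>i = 1..k. a i) * monomial h k a) =
      (\<Sum>a\<in>partitions k k. \<Sum>i = 1..k. real (c i) * (real (a i) * w (\<Sum>i = 1..k. a i) * monomial h k a))"
    unfolding of_nat_sum sum_distrib_right by (intro sum.cong refl) (simp add: mult_ac)
  also have "\<dots> = (\<Sum>i = 1..k. real (c i) *
      (\<Sum>a\<in>partitions k k. real (a i) * w (\<Sum>i = 1..k. a i) * monomial h k a))"
    by (subst sum.swap) (simp add: sum_distrib_left)
  also have "\<dots> = (\<Sum>i = 1..k. real (c i) * h i * partition_sum h (\<lambda>j. w (Suc j)) (k - i) (k - i))"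
  proof (rule sum.cong[OF refl])
    fix i assume i: "i \<in> {1..k}"
    have "partition_sum h (\<lambda>j. w (Suc j)) k (k - i) = partition_sum h (\<lambda>j. w (Suc j)) (k - i) (k - i)"
      by (rule partition_sum_large) simp
    then show "real (c i) * (\<Sum>a\<in>partitions k k. real (a i) * w (\<Sum>i = 1..k. a i) * monomial h k a) =
        real (c i) * h i * partition_sum h (\<lambda>j. w (Suc j)) (k - i) (k - i)"
      unfolding sum_partitions_part[OF i] using i by simp
  qed
  finally show ?thesis .
qed

text \<open>
  If \<open>H\<close> is the power series with coefficients \<open>h\<close> and constant term \<open>1\<close>, then
  \<open>inverse_coeff\<close> lists the coefficients of \<open>1 / H\<close> and \<open>log_coeff\<close> those of \<open>log H\<close> in positive degree, by
  the multinomial theorem applied to the powers of \<open>H - 1\<close>. In degree \<open>0\<close> the truncated subtraction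
  gives \<open>log_coeff\<close> the value \<open>1\<close>, which the factor \<open>k\<close> of the identities below removes.
\<close>

definition inverse_coeff :: "(nat \<Rightarrow> real) \<Rightarrow> nat \<Rightarrow> real" where
  "inverse_coeff h k = partition_sum h (\<lambda>j. (- 1) ^ j * fact j) k k"

definition log_coeff :: "(nat \<Rightarrow> real) \<Rightarrow> nat \<Rightarrow> real" where
  "log_coeff h k = partition_sum h (\<lambda>j. (- 1) ^ (j - 1) * fact (j - 1)) k k"

lemma inverse_coeff_0: "inverse_coeff h 0 = 1"
proof -
  have "partitions 0 0 = {\<lambda>_. 0}" by (auto simp: partitions_def)
  then show ?thesis by (simp add: inverse_coeff_def partition_sum_def monomial_def)
qed

text \<open>
  The number of parts is the sum of all \<open>a i\<close>. Taking it out of the factorial and removing one part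
  yields the coefficients of \<open>(1 / H) H = 1\<close> in positive degree.
\<close>

lemma inverse_coeff_rec:
  assumes "k \<ge> 1"
  shows "inverse_coeff h k = - (\<Sum>i = 1..k. h i * inverse_coeff h (k - i))"
proof -
  let ?w = "\<lambda>j. - ((- 1) ^ (j - 1) * fact (j - 1)) :: real"
  have "inverse_coeff h k =
      (\<Sum>a\<in>partitions k k. real (\<Sum>i = 1..k. 1 * a i) * ?w (\<Sum>i = 1..k. a i) * monomial h k a)"
    unfolding inverse_coeff_def partition_sum_def
  proof (rule sum.cong[OF refl])
    fix a assume a: "a \<in> partitions k k"
    have "(\<Sum>i = 1..k. a i) \<noteq> 0"
    proof
      assume "(\<Sum>i = 1..k. a i) = 0"
      then have "(\<Sum>i = 1..k. i * a i) = 0" by simp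
      then show False using a assms by (simp add: partitions_def)
    qed
    then obtain l where "(\<Sum>i = 1..k. a i) = Suc l" by (metis not0_implies_Suc)
    then show "(- 1) ^ (\<Sum>i = 1..k. a i) * fact (\<Sum>i = 1..k. a i) * monomial h k a =
        real (\<Sum>i = 1..k. 1 * a i) * ?w (\<Sum>i = 1..k. a i) * monomial h k a"
      by (simp add: fact_Suc)
  qed
  also have "\<dots> = (\<Sum>i = 1..k. real 1 * h i * partition_sum h (\<lambda>j. ?w (Suc j)) (k - i) (k - i))"
    by (rule sum_partitions_parts)
  also have "\<dots> = - (\<Sum>i = 1..k. h i * inverse_coeff h (k - i))"
    by (simp add: inverse_coeff_def partition_sum_def sum_negf)
  finally show ?thesis .
qed

text \<open>
  The same argument with \<open>k\<close> itself, the sum of all \<open>i * a i\<close>, yields the coefficients of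
  \<open>z (log H)' = z H' (1 / H)\<close>.
\<close>

lemma log_coeff_rec: "real k * log_coeff h k = (\<Sum>i = 1..k. real i * h i * inverse_coeff h (k - i))"
proof -
  let ?w = "\<lambda>j. (- 1) ^ (j - 1) * fact (j - 1) :: real"
  have "real k * log_coeff h k =
      (\<Sum>a\<in>partitions k k. real (\<Sum>i = 1..k. i * a i) * ?w (\<Sum>i = 1..k. a i) * monomial h k a)"
    unfolding log_coeff_def partition_sum_def sum_distrib_left
    by (rule sum.cong[OF refl]) (auto simp: partitions_def mult.assoc)
  also have "\<dots> = (\<Sum>i = 1..k. real i * h i * partition_sum h (\<lambda>j. ?w (Suc j)) (k - i) (k - i))"
    by (rule sum_partitions_parts)
  finally show ?thesis by (simp add: inverse_coeff_def)
qed

lemma log_coeff_convolution: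
  assumes "h 0 = 1" "n \<ge> 1"
  shows "(\<Sum>k = 1..n. real k * log_coeff h k * h (n - k)) = real n * h n"
proof -
  define H where "H = Abs_fps h"
  define R where "R = Abs_fps (inverse_coeff h)"
  define D where "D = Abs_fps (\<lambda>k. real k * h k)"
  define K where "K = Abs_fps (\<lambda>k. real k * log_coeff h k)"
  have "H * R = 1"
  proof (rule fps_ext)
    fix k show "fps_nth (H * R) k = fps_nth 1 k"
      using inverse_coeff_rec[of k h]
      by (cases "k = 0")
        (auto simp: fps_mult_nth H_def R_def assms(1) inverse_coeff_0 sum.atLeast_Suc_atMost)
  qed
  moreover have "K = D * R"
    by (rule fps_ext)
      (auto simp: fps_mult_nth K_def D_def R_def log_coeff_rec sum.atLeast_Suc_atMost)
  ultimately have "K * H = D" by (simp add: mult.assoc mult.commute)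
  then have "fps_nth (K * H) n = fps_nth D n" by simp
  then show ?thesis
    by (simp add: fps_mult_nth K_def D_def H_def sum.atLeast_Suc_atMost)
qed

section \<open>Evaluation at a character\<close>

lemma linear_pairing: "linear (\<lambda>x. pairing x X)"
  unfolding pairing_def by (rule linear_linear_extension)

context
  fixes X :: "forest \<Rightarrow> real"
  assumes character: "X {#} = 1" "\<And>F G. X (F + G) = X F * X G"
begin

lemma pairing_1: "pairing 1 X = 1"
  using linear_extension_basis[of X "{#}"] by (simp add: pairing_def character)

lemma pairing_mult: "pairing (x * y) X = pairing x X * pairing y X"
  unfolding pairing_def
  by (rule linear_extension_mult2)
    (auto simp: character linear_iff distrib_left distrib_right mult.left_commute)

lemma pairing_power: "pairing (x ^ n) X = pairing x X ^ n"
  by (induction n) (simp_all add: pairing_1 pairing_mult)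

lemma pairing_prod: "pairing (\<Prod>i\<in>I. f i) X = (\<Prod>i\<in>I. pairing (f i) X)"
  by (induction I rule: infinite_finite_induct) (simp_all add: pairing_1 pairing_mult)

text \<open>
  The coefficients of \<open>P_polynomial\<close> are those of the logarithm series, and a character evaluates
  its monomials factor by factor.
\<close>

lemma pairing_P_polynomial: "pairing (P_polynomial p k) X = log_coeff (\<lambda>i. pairing (growth_power p i) X) k"
  unfolding P_polynomial_def log_coeff_def partition_sum_def partitions_def monomial_def
    linear_sum[OF linear_pairing] linear_scale[OF linear_pairing]
  by (simp add: pairing_prod pairing_power prod_dividef)

lemma growth_power_recursion:
  assumes "n \<ge> 1"
  shows "pairing (growth_power p n) X =
    (\<Sum>k = 1..n. real k / real n * pairing (P_polynomial p k) X * pairing (growth_power p (n - k)) X)"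
proof -
  let ?h = "\<lambda>i. pairing (growth_power p i) X"
  have "real n * ?h n = (\<Sum>k = 1..n. real k * log_coeff ?h k * ?h (n - k))"
    using log_coeff_convolution[of ?h n] assms by (simp add: pairing_1)
  then have "?h n = (\<Sum>k = 1..n. real k * log_coeff ?h k * ?h (n - k)) / real n"
    using assms by (simp add: field_simps)
  then show ?thesis
    by (simp add: pairing_P_polynomial sum_divide_distrib)
qed

text \<open>
  Since \<open>X\<close> is a character, the right-hand side is the value of \<open>y\<close> at the quasi-shuffle products of
  \<open>letter_power_recursion\<close>.
\<close>

lemma quasi_geometric_recursion:
  fixes y :: "QSh \<Rightarrow> real"
  assumes y: "linear y" "\<And>x. pairing x X = y (atilde x)" and m: "m \<ge> 1" and n: "n \<ge> 1"
  defines "\<pi> \<equiv> \<lambda>l. primitive_projection (basis (isolated_vertices l))"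
  shows "pairing (growth_power (\<pi> m) n) X =
    (\<Sum>k = 1..n. (- 1) ^ (k - 1) / real n * pairing (\<pi> (m * k)) X * pairing (growth_power (\<pi> m) (n - k)) X)"
proof -
  have \<pi>: "\<pi> l \<in> primitives" "l \<ge> 1 \<Longrightarrow> letter_part (\<pi> l) = basis [l - 1]" for l
    by (simp_all add: \<pi>_def primitive_projection_eq proj_forest_primitive letter_part_proj
        letter_forest_isolated_vertices)
  have power: "atilde (growth_power (\<pi> m) j) = basis (replicate j (m - 1))" for j
    by (rule atilde_growth_power) (use \<pi> m in auto)
  have product: "pairing (\<pi> (m * k)) X * pairing (growth_power (\<pi> m) (n - k)) X =
      y (quasi_shuffle [m * k - 1] (replicate (n - k) (m - 1)))" if "k \<ge> 1" for k
  proof -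
    have "atilde (\<pi> (m * k)) = basis [m * k - 1]"
      using that m by (simp add: atilde_primitive \<pi>)
    then have "atilde (\<pi> (m * k) * growth_power (\<pi> m) (n - k)) =
        quasi_shuffle [m * k - 1] (replicate (n - k) (m - 1))"
      by (simp add: atilde_mult power quasi_shuffle_times_basis)
    then have "pairing (\<pi> (m * k) * growth_power (\<pi> m) (n - k)) X =
        y (quasi_shuffle [m * k - 1] (replicate (n - k) (m - 1)))"
      by (simp only: y(2))
    then show ?thesis by (simp only: pairing_mult)
  qed
  have "real n * pairing (growth_power (\<pi> m) n) X = y (real n *\<^sub>R basis (replicate n (m - 1)))"
    by (simp add: y(2) power linear_scale[OF y(1)])
  also have "\<dots> = (\<Sum>k = 1..n. (- 1) ^ (k - 1) * y (quasi_shuffle [m * k - 1] (replicate (n - k) (m - 1))))"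
    by (simp only: letter_power_recursion[OF m n, symmetric] linear_sum[OF y(1)] linear_scale[OF y(1)]
        real_scaleR_def)
  also have "\<dots> = (\<Sum>k = 1..n. (- 1) ^ (k - 1) *
      (pairing (\<pi> (m * k)) X * pairing (growth_power (\<pi> m) (n - k)) X))"
    by (rule sum.cong) (auto simp: product)
  finally have "pairing (growth_power (\<pi> m) n) X = (\<Sum>k = 1..n. (- 1) ^ (k - 1) *
      (pairing (\<pi> (m * k)) X * pairing (growth_power (\<pi> m) (n - k)) X)) / real n"
    using n by (simp add: field_simps)
  then show ?thesis by (simp add: sum_divide_distrib mult.assoc)
qed

end

lemma signature_character:
  assumes "is_signature \<rho> T X S" "0 \<le> s" "s \<le> t" "t \<le> T"
  shows "S s t {#} = 1" "S s t (F + G) = S s t F * S s t G"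
  using assms by (auto simp: is_signature_def multiplicative_functional_def)

theorem theorem4p5:
  fixes \<rho> T :: real
    and X S :: "real \<Rightarrow> real \<Rightarrow> forest \<Rightarrow> real"
  assumes "\<rho> > 0"
    and "branched_rough_path \<rho> T X"
    and "is_signature \<rho> T X S"
  shows
    "(\<forall>p \<in> primitives. \<forall>s t. 0 \<le> s \<and> s \<le> t \<and> t \<le> T \<longrightarrow> (\<forall>n \<ge> 1.
        pairing (growth_power p n) (S s t) =
          (\<Sum>k = 1..n. real k / real n * pairing (P_polynomial p k) (S s t)
             * pairing (growth_power p (n - k)) (S s t)))) \<and>
     (quasi_geometric T S \<longrightarrow>
        (\<forall>s t. 0 \<le> s \<and> s \<le> t \<and> t \<le> T \<longrightarrow> (\<forall>m \<ge> 1. \<forall>n \<ge> 1.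
          pairing (growth_power (primitive_projection (basis (isolated_vertices m))) n) (S s t) =
            (\<Sum>k = 1..n. (- 1) ^ (k - 1) / real n
               * pairing (primitive_projection (basis (isolated_vertices (m * k)))) (S s t)
               * pairing (growth_power (primitive_projection (basis (isolated_vertices m))) (n - k))
                   (S s t)))))"
proof (intro conjI ballI allI impI)
  fix p s t n
  assume st: "0 \<le> s \<and> s \<le> t \<and> t \<le> T" and n: "(1::nat) \<le> n"
  show "pairing (growth_power p n) (S s t) =
      (\<Sum>k = 1..n. real k / real n * pairing (P_polynomial p k) (S s t)
         * pairing (growth_power p (n - k)) (S s t))"
    using signature_character[OF assms(3)] st n by (intro growth_power_recursion) auto
next
  fix s t m n
  assume q: "quasi_geometric T S" and st: "0 \<le> s \<and> s \<le> t \<and> t \<le> T"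
    and m: "(1::nat) \<le> m" and n: "(1::nat) \<le> n"
  obtain y :: "QSh \<Rightarrow> real" where y: "linear y" "\<And>x. pairing x (S s t) = y (atilde x)"
    using q st unfolding quasi_geometric_def by blast
  show "pairing (growth_power (primitive_projection (basis (isolated_vertices m))) n) (S s t) =
      (\<Sum>k = 1..n. (- 1) ^ (k - 1) / real n
         * pairing (primitive_projection (basis (isolated_vertices (m * k)))) (S s t)
         * pairing (growth_power (primitive_projection (basis (isolated_vertices m))) (n - k)) (S s t))"
    using signature_character[OF assms(3)] st
    by (intro quasi_geometric_recursion[OF _ _ y m n]) auto
qed

end
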